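(* Let $\hat{\mathcal{D}}_3\subset\mathbb{A}^9$ be the hypersurface $\det(x)=0$ in the space of $3\times3$ matrices $x=(x_{ij})$, and let $\hat\Sigma_{3,0}\subset\mathbb{A}^9$ be the normal crossings divisor $$x_{12}\,x_{13}\,x_{23}\,(x_{11}+x_{12}+x_{13})(x_{21}+x_{22}+x_{23})(x_{31}+x_{32}+x_{33})=0.$$ Then, in the Grothendieck ring of varieties, $$[\hat\Sigma_{3,0}\smallsetminus(\hat{\mathcal{D}}_3\cap\hat\Sigma_{3,0})]=\mathbb{L}\,(6\mathbb{L}^4-3\mathbb{L}^3+2\mathbb{L}^2+2\mathbb{L}-1)(\mathbb{L}-1)^3.$$
   Context: $\mathbb{L}=[\mathbb{A}^1]$ denotes the class of the affine line in the Grothendieck ring of varieties (over $\mathbb{Q}$). *)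

theory Defs
  imports "HOL-Analysis.Analysis" "HOL-Library.Poly_Mapping"
begin

text \<open>
  A variety over the rationals (a reduced separated scheme of finite type, not necessarily
  irreducible) is encoded by its set of complex points, with the topology of closed sets defined
  over the rationals and the sheaf of complex-valued functions that are regular over the rationals
  (a variety with its rational structure in the sense of Weil and Borel, the complex numbers being
  the universal domain).  This is a fully faithful encoding, since the rational coordinate ring of
  a reduced affine scheme embeds into the functions on its complex points.  Two points conjugate
  over the rationals are not separated by the topology, but they are in general separated by the
  functions.
\<close>

section \<open>Spaces with functions\<close>

record 'a fspace =
  top_of :: "'a topology"
  regular :: "'a set \<Rightarrow> ('a \<Rightarrow> complex) set"

abbreviation points :: "'a fspace \<Rightarrow> 'a set"
  where "points X \<equiv> topspace (top_of X)"

text \<open>Only the values on \<open>U\<close> of a member of \<open>regular X U\<close> matter, and only open \<open>U\<close> matter.  In a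
  variety these sets are automatically algebras over the rationals, because they are so locally.\<close>

definition function_sheaf :: "'a fspace \<Rightarrow> bool" where
  "function_sheaf X \<longleftrightarrow>
     (\<forall>U f g. openin (top_of X) U \<and> f \<in> regular X U \<and> (\<forall>x\<in>U. f x = g x) \<longrightarrow> g \<in> regular X U) \<and>
     (\<forall>U V f. openin (top_of X) U \<and> openin (top_of X) V \<and> V \<subseteq> U \<and> f \<in> regular X U
        \<longrightarrow> f \<in> regular X V) \<and>
     (\<forall>\<U> f. (\<forall>U\<in>\<U>. openin (top_of X) U \<and> f \<in> regular X U) \<longrightarrow> f \<in> regular X (\<Union>\<U>))"

definition morphism :: "'a fspace \<Rightarrow> 'b fspace \<Rightarrow> ('a \<Rightarrow> 'b) \<Rightarrow> bool" where
  "morphism X Y \<phi> \<longleftrightarrow> continuous_map (top_of X) (top_of Y) \<phi> \<and>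
     (\<forall>V f. openin (top_of Y) V \<and> f \<in> regular Y V
        \<longrightarrow> f \<circ> \<phi> \<in> regular X {x \<in> points X. \<phi> x \<in> V})"

definition isomorphic :: "'a fspace \<Rightarrow> 'b fspace \<Rightarrow> bool" where
  "isomorphic X Y \<longleftrightarrow> (\<exists>\<phi> \<psi>. morphism X Y \<phi> \<and> morphism Y X \<psi> \<and>
     (\<forall>x\<in>points X. \<psi> (\<phi> x) = x) \<and> (\<forall>y\<in>points Y. \<phi> (\<psi> y) = y))"

text \<open>For \<open>S\<close> open, closed or locally closed this is the (reduced) subvariety supported on \<open>S\<close>.\<close>

definition induced :: "'a fspace \<Rightarrow> 'a set \<Rightarrow> 'a fspace" where
  "induced X S = \<lparr> top_of = subtopology (top_of X) S,
     regular = (\<lambda>U. {f. \<forall>x\<in>U. \<exists>V g. openin (top_of X) V \<and> x \<in> V \<inter> S \<and> g \<in> regular X V \<and>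
                        (\<forall>y\<in>V \<inter> U. f y = g y)}) \<rparr>"

section \<open>Affine space over the rationals\<close>

text \<open>A point of affine \<open>n\<close>-space is a list of length \<open>n\<close>; the coordinates are numbered from 0.\<close>

inductive_set ratpoly :: "nat \<Rightarrow> (complex list \<Rightarrow> complex) set" for n :: nat where
  const: "(\<lambda>x. of_rat c) \<in> ratpoly n"
| coord: "i < n \<Longrightarrow> (\<lambda>x. x ! i) \<in> ratpoly n"
| add: "p \<in> ratpoly n \<Longrightarrow> q \<in> ratpoly n \<Longrightarrow> (\<lambda>x. p x + q x) \<in> ratpoly n"
| mult: "p \<in> ratpoly n \<Longrightarrow> q \<in> ratpoly n \<Longrightarrow> (\<lambda>x. p x * q x) \<in> ratpoly n"

definition zariski :: "nat \<Rightarrow> complex list topology" where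
  "zariski n = topology (\<lambda>U. \<exists>S \<subseteq> ratpoly n. U = {x. length x = n \<and> (\<exists>p\<in>S. p x \<noteq> 0)})"

definition affine_space :: "nat \<Rightarrow> complex list fspace" where
  "affine_space n = \<lparr> top_of = zariski n,
     regular = (\<lambda>U. {f. \<forall>x\<in>U. \<exists>V p q. openin (zariski n) V \<and> x \<in> V \<and>
                        p \<in> ratpoly n \<and> q \<in> ratpoly n \<and>
                        (\<forall>y\<in>V \<inter> U. q y \<noteq> 0 \<and> f y = p y / q y)}) \<rparr>"

section \<open>Varieties over the rationals\<close>

definition affine_variety :: "'a fspace \<Rightarrow> bool" where
  "affine_variety X \<longleftrightarrow>
     (\<exists>n C. closedin (zariski n) C \<and> isomorphic X (induced (affine_space n) C))"

text \<open>Two morphisms from an affine variety agree on a closed set; for a space that is locally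
  an affine variety this says that the diagonal is closed.\<close>

definition separated_space :: "'a fspace \<Rightarrow> bool" where
  "separated_space X \<longleftrightarrow>
     (\<forall>n C \<phi> \<psi>. closedin (zariski n) C \<and>
        morphism (induced (affine_space n) C) X \<phi> \<and> morphism (induced (affine_space n) C) X \<psi>
        \<longrightarrow> closedin (zariski n) {x \<in> C. \<phi> x = \<psi> x})"

definition is_variety :: "'a fspace \<Rightarrow> bool" where
  "is_variety X \<longleftrightarrow> function_sheaf X \<and> separated_space X \<and>
     (\<exists>\<U>. finite \<U> \<and> \<Union>\<U> = points X \<and>
        (\<forall>U\<in>\<U>. openin (top_of X) U \<and> affine_variety (induced X U)))"

text \<open>Every variety has at most continuum many points, hence is isomorphic to one whose points are
  lists of complex numbers.\<close>

typedef variety = "{X :: complex list fspace. is_variety X}"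
proof
  let ?E = "\<lparr> top_of = discrete_topology ({} :: complex list set), regular = (\<lambda>_. UNIV) \<rparr>"
  have "separated_space ?E"
    unfolding separated_space_def
  proof (intro allI impI, elim conjE)
    fix n C and \<phi> \<psi> :: "complex list \<Rightarrow> complex list"
    assume C: "closedin (zariski n) C" and m: "morphism (induced (affine_space n) C) ?E \<phi>"
    have "points (induced (affine_space n) C) = C"
      using closedin_subset[OF C] by (auto simp: induced_def affine_space_def)
    then have "C = {}"
      using m by (auto simp: morphism_def continuous_map_def)
    then show "closedin (zariski n) {x \<in> C. \<phi> x = \<psi> x}" by simp
  qed
  then show "?E \<in> {X. is_variety X}"
    by (auto simp: is_variety_def function_sheaf_def intro!: exI[of _ "{}"])
qed

section \<open>Locally closed subsets of affine space are varieties\<close>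

lemma istopology_zariski:
  "istopology (\<lambda>U. \<exists>S \<subseteq> ratpoly n. U = {x. length x = n \<and> (\<exists>p\<in>S. p x \<noteq> 0)})"
  unfolding istopology_def
proof (intro conjI allI impI)
  fix U V
  assume "\<exists>S \<subseteq> ratpoly n. U = {x. length x = n \<and> (\<exists>p\<in>S. p x \<noteq> 0)}"
    and "\<exists>S \<subseteq> ratpoly n. V = {x. length x = n \<and> (\<exists>p\<in>S. p x \<noteq> 0)}"
  then obtain S T where S: "S \<subseteq> ratpoly n" "U = {x. length x = n \<and> (\<exists>p\<in>S. p x \<noteq> 0)}"
    and T: "T \<subseteq> ratpoly n" "V = {x. length x = n \<and> (\<exists>p\<in>T. p x \<noteq> 0)}" by blast
  let ?R = "{\<lambda>x. p x * q x |p q. p \<in> S \<and> q \<in> T}"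
  have "?R \<subseteq> ratpoly n" using S(1) T(1) by (auto intro: ratpoly.mult)
  moreover have "U \<inter> V = {x. length x = n \<and> (\<exists>p\<in>?R. p x \<noteq> 0)}"
    unfolding S(2) T(2) by fastforce
  ultimately show "\<exists>S \<subseteq> ratpoly n. U \<inter> V = {x. length x = n \<and> (\<exists>p\<in>S. p x \<noteq> 0)}" by blast
next
  fix \<K> :: "complex list set set"
  assume "\<forall>K\<in>\<K>. \<exists>S \<subseteq> ratpoly n. K = {x. length x = n \<and> (\<exists>p\<in>S. p x \<noteq> 0)}"
  then obtain F where "\<forall>K\<in>\<K>. F K \<subseteq> ratpoly n \<and> K = {x. length x = n \<and> (\<exists>p\<in>F K. p x \<noteq> 0)}"
    by (rule bchoice[THEN exE])
  then have F: "\<And>K. K \<in> \<K> \<Longrightarrow> F K \<subseteq> ratpoly n"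
      "\<And>K. K \<in> \<K> \<Longrightarrow> K = {x. length x = n \<and> (\<exists>p\<in>F K. p x \<noteq> 0)}" by auto
  have "\<Union>(F ` \<K>) \<subseteq> ratpoly n" using F(1) by blast
  moreover have "\<Union>\<K> = {x. length x = n \<and> (\<exists>p\<in>\<Union>(F ` \<K>). p x \<noteq> 0)}"
    using F(2) by blast
  ultimately show "\<exists>S \<subseteq> ratpoly n. \<Union>\<K> = {x. length x = n \<and> (\<exists>p\<in>S. p x \<noteq> 0)}" by blast
qed

lemma openin_zariski:
  "openin (zariski n) U \<longleftrightarrow> (\<exists>S \<subseteq> ratpoly n. U = {x. length x = n \<and> (\<exists>p\<in>S. p x \<noteq> 0)})"
  unfolding zariski_def by (simp only: topology_inverse'[OF istopology_zariski])

lemma ratpoly_0: "(\<lambda>x. 0) \<in> ratpoly n"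
  using ratpoly.const[of 0] by simp

lemma ratpoly_1: "(\<lambda>x. 1) \<in> ratpoly n"
  using ratpoly.const[of 1] by simp

lemma ratpoly_uminus: "p \<in> ratpoly n \<Longrightarrow> (\<lambda>x. - p x) \<in> ratpoly n"
  using ratpoly.mult[OF ratpoly.const[of "- 1"]] by simp

lemma ratpoly_diff: "p \<in> ratpoly n \<Longrightarrow> q \<in> ratpoly n \<Longrightarrow> (\<lambda>x. p x - q x) \<in> ratpoly n"
  using ratpoly.add[OF _ ratpoly_uminus] by fastforce

lemma openin_zariski_nonzero: "p \<in> ratpoly n \<Longrightarrow> openin (zariski n) {x. length x = n \<and> p x \<noteq> 0}"
  unfolding openin_zariski by (rule exI[of _ "{p}"]) auto

lemma topspace_zariski [simp]: "topspace (zariski n) = {x. length x = n}"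
proof
  show "topspace (zariski n) \<subseteq> {x. length x = n}"
    using openin_topspace[of "zariski n"] unfolding openin_zariski by (elim exE conjE) auto
  have "openin (zariski n) {x. length x = n}"
    using openin_zariski_nonzero[OF ratpoly_1] by simp
  then show "{x. length x = n} \<subseteq> topspace (zariski n)" by (rule openin_subset)
qed

lemma closedin_zariski_zero: "p \<in> ratpoly n \<Longrightarrow> closedin (zariski n) {x. length x = n \<and> p x = 0}"
proof -
  assume p: "p \<in> ratpoly n"
  have "{x. length x = n} - {x. length x = n \<and> p x = 0} = {x. length x = n \<and> p x \<noteq> 0}" by auto
  then show ?thesis using openin_zariski_nonzero[OF p] by (auto simp: closedin_def)
qed

lemma top_of_affine_space [simp]: "top_of (affine_space n) = zariski n"
  by (simp add: affine_space_def)

lemma top_of_induced [simp]: "top_of (induced X S) = subtopology (top_of X) S"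
  by (simp add: induced_def)

lemma function_sheafD:
  assumes "function_sheaf X"
  shows "openin (top_of X) U \<Longrightarrow> f \<in> regular X U \<Longrightarrow> (\<And>x. x \<in> U \<Longrightarrow> f x = g x) \<Longrightarrow> g \<in> regular X U"
    and "openin (top_of X) U \<Longrightarrow> openin (top_of X) V \<Longrightarrow> V \<subseteq> U \<Longrightarrow> f \<in> regular X U \<Longrightarrow> f \<in> regular X V"
  by (rule assms[unfolded function_sheaf_def, THEN conjunct1, rule_format, of U f g], blast)
    (rule assms[unfolded function_sheaf_def, THEN conjunct2, THEN conjunct1, rule_format, of U V f], blast)

lemma regular_affine_space_iff:
  "f \<in> regular (affine_space n) U \<longleftrightarrow>
     (\<forall>x\<in>U. \<exists>V p q. openin (zariski n) V \<and> x \<in> V \<and> p \<in> ratpoly n \<and> q \<in> ratpoly n \<and>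
                        (\<forall>y\<in>V \<inter> U. q y \<noteq> 0 \<and> f y = p y / q y))"
  by (simp only: affine_space_def fspace.simps mem_Collect_eq)

lemma regular_induced_iff:
  "f \<in> regular (induced X S) U \<longleftrightarrow>
     (\<forall>x\<in>U. \<exists>V g. openin (top_of X) V \<and> x \<in> V \<inter> S \<and> g \<in> regular X V \<and> (\<forall>y\<in>V \<inter> U. f y = g y))"
  by (simp only: induced_def fspace.simps mem_Collect_eq)

lemma regular_affine_spaceE:
  assumes "f \<in> regular (affine_space n) U" "x \<in> U"
  obtains V p q where "openin (zariski n) V" "x \<in> V" "p \<in> ratpoly n" "q \<in> ratpoly n"
    "\<And>y. y \<in> V \<Longrightarrow> y \<in> U \<Longrightarrow> q y \<noteq> 0" "\<And>y. y \<in> V \<Longrightarrow> y \<in> U \<Longrightarrow> f y = p y / q y"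
proof -
  obtain V p q where *: "openin (zariski n) V \<and> x \<in> V \<and> p \<in> ratpoly n \<and> q \<in> ratpoly n \<and>
                        (\<forall>y\<in>V \<inter> U. q y \<noteq> 0 \<and> f y = p y / q y)"
    using assms(1)[unfolded regular_affine_space_iff, rule_format, OF assms(2)] by (elim exE)
  show thesis by (rule that[of V p q]) (use * in auto)
qed

lemma regular_inducedE:
  assumes "f \<in> regular (induced X S) U" "x \<in> U"
  obtains V g where "openin (top_of X) V" "x \<in> V" "x \<in> S" "g \<in> regular X V"
    "\<And>y. y \<in> V \<Longrightarrow> y \<in> U \<Longrightarrow> f y = g y"
proof -
  obtain V g where *: "openin (top_of X) V \<and> x \<in> V \<inter> S \<and> g \<in> regular X V \<and>
                        (\<forall>y\<in>V \<inter> U. f y = g y)"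
    using assms(1)[unfolded regular_induced_iff, rule_format, OF assms(2)] by (elim exE)
  show thesis by (rule that[of V g]) (use * in auto)
qed

lemma function_sheaf_affine_space: "function_sheaf (affine_space n)"
  unfolding function_sheaf_def
proof (intro conjI allI impI; (elim conjE)?)
  fix U f g assume f: "f \<in> regular (affine_space n) U" and e: "\<forall>x\<in>U. f x = g x"
  have "(\<forall>y\<in>V \<inter> U. q y \<noteq> 0 \<and> g y = p y / q y) \<longleftrightarrow> (\<forall>y\<in>V \<inter> U. q y \<noteq> 0 \<and> f y = p y / q y)" for V p q
    using e by auto
  then show "g \<in> regular (affine_space n) U"
    using f by (simp only: regular_affine_space_iff)
next
  fix U V f assume VU: "V \<subseteq> U" and f: "f \<in> regular (affine_space n) U"
  show "f \<in> regular (affine_space n) V"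
    unfolding regular_affine_space_iff
  proof
    fix x assume "x \<in> V"
    then have "x \<in> U" using VU by blast
    with f obtain W p q where W: "openin (zariski n) W" "x \<in> W" "p \<in> ratpoly n" "q \<in> ratpoly n"
      "\<And>y. y \<in> W \<Longrightarrow> y \<in> U \<Longrightarrow> q y \<noteq> 0" "\<And>y. y \<in> W \<Longrightarrow> y \<in> U \<Longrightarrow> f y = p y / q y"
      by (rule regular_affine_spaceE) blast
    show "\<exists>W p q. openin (zariski n) W \<and> x \<in> W \<and> p \<in> ratpoly n \<and> q \<in> ratpoly n \<and>
                        (\<forall>y\<in>W \<inter> V. q y \<noteq> 0 \<and> f y = p y / q y)"
      by (rule exI[of _ W], rule exI[of _ p], rule exI[of _ q]) (use W VU in auto)
  qed
next
  fix \<U> f assume a: "\<forall>U\<in>\<U>. openin (top_of (affine_space n)) U \<and> f \<in> regular (affine_space n) U"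
  show "f \<in> regular (affine_space n) (\<Union>\<U>)"
    unfolding regular_affine_space_iff
  proof
    fix x assume "x \<in> \<Union>\<U>"
    then obtain U where U: "U \<in> \<U>" "x \<in> U" by blast
    then have oU: "openin (zariski n) U" and f: "f \<in> regular (affine_space n) U" using a by auto
    obtain V p q where V: "openin (zariski n) V" "x \<in> V" "p \<in> ratpoly n" "q \<in> ratpoly n"
      "\<And>y. y \<in> V \<Longrightarrow> y \<in> U \<Longrightarrow> q y \<noteq> 0" "\<And>y. y \<in> V \<Longrightarrow> y \<in> U \<Longrightarrow> f y = p y / q y"
      using f U(2) by (rule regular_affine_spaceE) blast
    show "\<exists>W p q. openin (zariski n) W \<and> x \<in> W \<and> p \<in> ratpoly n \<and> q \<in> ratpoly n \<and>
                        (\<forall>y\<in>W \<inter> \<Union>\<U>. q y \<noteq> 0 \<and> f y = p y / q y)"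
      by (rule exI[of _ "V \<inter> U"], rule exI[of _ p], rule exI[of _ q]) (use V U oU in auto)
  qed
qed

lemma function_sheaf_induced:
  assumes "function_sheaf X"
  shows "function_sheaf (induced X S)"
  unfolding function_sheaf_def
proof (intro conjI allI impI; (elim conjE)?)
  fix U f g assume f: "f \<in> regular (induced X S) U" and e: "\<forall>x\<in>U. f x = g x"
  have "(\<forall>y\<in>V \<inter> U. g y = h y) \<longleftrightarrow> (\<forall>y\<in>V \<inter> U. f y = h y)" for V h
    using e by auto
  then show "g \<in> regular (induced X S) U"
    using f by (simp only: regular_induced_iff)
next
  fix U V f assume VU: "V \<subseteq> U" and f: "f \<in> regular (induced X S) U"
  show "f \<in> regular (induced X S) V"
    unfolding regular_induced_iff
  proof
    fix x assume "x \<in> V"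
    then have "x \<in> U" using VU by blast
    with f obtain W g where W: "openin (top_of X) W" "x \<in> W" "x \<in> S" "g \<in> regular X W"
      "\<And>y. y \<in> W \<Longrightarrow> y \<in> U \<Longrightarrow> f y = g y"
      by (rule regular_inducedE) blast
    show "\<exists>W g. openin (top_of X) W \<and> x \<in> W \<inter> S \<and> g \<in> regular X W \<and> (\<forall>y\<in>W \<inter> V. f y = g y)"
      by (rule exI[of _ W], rule exI[of _ g]) (use W VU in auto)
  qed
next
  fix \<U> f assume a: "\<forall>U\<in>\<U>. openin (top_of (induced X S)) U \<and> f \<in> regular (induced X S) U"
  show "f \<in> regular (induced X S) (\<Union>\<U>)"
    unfolding regular_induced_iff
  proof
    fix x assume "x \<in> \<Union>\<U>"
    then obtain U where U: "U \<in> \<U>" "x \<in> U" by blast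
    then have oU: "openin (subtopology (top_of X) S) U" and f: "f \<in> regular (induced X S) U"
      using a by auto
    obtain V g where V: "openin (top_of X) V" "x \<in> V" "x \<in> S" "g \<in> regular X V"
      "\<And>y. y \<in> V \<Longrightarrow> y \<in> U \<Longrightarrow> f y = g y"
      using f U(2) by (rule regular_inducedE) blast
    obtain W where W: "openin (top_of X) W" "U = W \<inter> S"
      using oU by (auto simp: openin_subtopology)
    have N: "K \<subseteq> S" if "K \<in> \<U>" for K
      using a that openin_subset[of "subtopology (top_of X) S" K] by auto
    have o: "openin (top_of X) (V \<inter> W)" using V(1) W(1) by (rule openin_Int)
    have g: "g \<in> regular X (V \<inter> W)"
      using function_sheafD(2)[OF assms V(1) o _ V(4)] by simp
    show "\<exists>V g. openin (top_of X) V \<and> x \<in> V \<inter> S \<and> g \<in> regular X V \<and> (\<forall>y\<in>V \<inter> \<Union>\<U>. f y = g y)"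
    proof (rule exI[of _ "V \<inter> W"], rule exI[of _ g], intro conjI ballI)
      fix y assume y: "y \<in> V \<inter> W \<inter> \<Union>\<U>"
      then have "y \<in> S" using N by blast
      then show "f y = g y" using V(5)[of y] W(2) y by blast
    qed (use o g V U W in auto)
  qed
qed

lemma induced_induced:
  assumes X: "function_sheaf X" and TS: "T \<subseteq> S"
  shows "induced (induced X S) T = induced X T"
proof -
  have "regular (induced (induced X S) T) U = regular (induced X T) U" (is "?L = ?R") for U
  proof (intro equalityI subsetI)
    fix f assume f: "f \<in> ?L"
    have US: "y \<in> S" if "y \<in> U" for y
      using f that by (rule regular_inducedE) (use TS in blast)
    show "f \<in> ?R"
      unfolding regular_induced_iff
    proof
      fix x assume x: "x \<in> U"
      obtain V g where V: "openin (top_of (induced X S)) V" "x \<in> V" "x \<in> T"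
          "g \<in> regular (induced X S) V" "\<And>y. y \<in> V \<Longrightarrow> y \<in> U \<Longrightarrow> f y = g y"
        using f x by (rule regular_inducedE) blast
      obtain V' where V': "openin (top_of X) V'" "V = V' \<inter> S"
        using V(1) by (auto simp: openin_subtopology)
      obtain W h where W: "openin (top_of X) W" "x \<in> W" "h \<in> regular X W"
          "\<And>y. y \<in> W \<Longrightarrow> y \<in> V \<Longrightarrow> g y = h y"
        using V(4,2) by (rule regular_inducedE) blast
      have o: "openin (top_of X) (V' \<inter> W)" using V'(1) W(1) by (rule openin_Int)
      have h: "h \<in> regular X (V' \<inter> W)"
        using function_sheafD(2)[OF X W(1) o _ W(3)] by simp
      show "\<exists>V g. openin (top_of X) V \<and> x \<in> V \<inter> T \<and> g \<in> regular X V \<and> (\<forall>y\<in>V \<inter> U. f y = g y)"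
      proof (rule exI[of _ "V' \<inter> W"], rule exI[of _ h], intro conjI ballI)
        fix y assume y: "y \<in> V' \<inter> W \<inter> U"
        then have "y \<in> V" using US V'(2) by blast
        then show "f y = h y" using V(5)[of y] W(4)[of y] y by simp
      qed (use o h V V' W in auto)
    qed
  next
    fix f assume f: "f \<in> ?R"
    show "f \<in> ?L"
      unfolding regular_induced_iff[of f "induced X S"]
    proof
      fix x assume x: "x \<in> U"
      obtain V g where V: "openin (top_of X) V" "x \<in> V" "x \<in> T" "g \<in> regular X V"
          "\<And>y. y \<in> V \<Longrightarrow> y \<in> U \<Longrightarrow> f y = g y"
        using f x by (rule regular_inducedE) blast
      have g: "g \<in> regular (induced X S) (V \<inter> S)"
        unfolding regular_induced_iff
        by (rule ballI, rule exI[of _ V], rule exI[of _ g]) (use V in auto)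
      show "\<exists>V g. openin (top_of (induced X S)) V \<and> x \<in> V \<inter> T \<and> g \<in> regular (induced X S) V \<and>
          (\<forall>y\<in>V \<inter> U. f y = g y)"
        by (rule exI[of _ "V \<inter> S"], rule exI[of _ g])
          (use V TS g in \<open>auto simp: openin_subtopology\<close>)
    qed
  qed
  then have "regular (induced (induced X S) T) = regular (induced X T)" by (rule ext)
  moreover have "top_of (induced (induced X S) T) = top_of (induced X T)"
    using TS by (simp add: subtopology_subtopology Int_absorb1)
  ultimately show ?thesis by simp
qed

text \<open>Regular functions on a subset of affine space.\<close>

lemma regular_quasi_affine:
  "f \<in> regular (induced (affine_space n) S) U \<longleftrightarrow>
     U \<subseteq> S \<and> (\<forall>x\<in>U. \<exists>V p q. openin (zariski n) V \<and> x \<in> V \<and> p \<in> ratpoly n \<and> q \<in> ratpoly n \<and>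
                        (\<forall>y\<in>V \<inter> U. q y \<noteq> 0 \<and> f y = p y / q y))"
  (is "?L \<longleftrightarrow> ?R")
proof
  assume L: ?L
  show ?R
  proof (intro conjI ballI subsetI)
    fix x assume x: "x \<in> U"
    obtain V g where V: "openin (zariski n) V" "x \<in> V" "x \<in> S" "g \<in> regular (affine_space n) V"
        "\<And>y. y \<in> V \<Longrightarrow> y \<in> U \<Longrightarrow> f y = g y"
      using L x by (rule regular_inducedE) auto
    show "x \<in> S" by fact
    obtain W p q where W: "openin (zariski n) W" "x \<in> W" "p \<in> ratpoly n" "q \<in> ratpoly n"
        "\<And>y. y \<in> W \<Longrightarrow> y \<in> V \<Longrightarrow> q y \<noteq> 0" "\<And>y. y \<in> W \<Longrightarrow> y \<in> V \<Longrightarrow> g y = p y / q y"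
      using V(4,2) by (rule regular_affine_spaceE) blast
    have o: "openin (zariski n) (V \<inter> W)" using V(1) W(1) by (rule openin_Int)
    show "\<exists>V p q. openin (zariski n) V \<and> x \<in> V \<and> p \<in> ratpoly n \<and> q \<in> ratpoly n \<and>
                        (\<forall>y\<in>V \<inter> U. q y \<noteq> 0 \<and> f y = p y / q y)"
      by (rule exI[of _ "V \<inter> W"], rule exI[of _ p], rule exI[of _ q]) (use o V W in auto)
  qed
next
  assume R: ?R
  show ?L
    unfolding regular_induced_iff
  proof
    fix x assume x: "x \<in> U"
    obtain V p q where V: "openin (zariski n) V" "x \<in> V" "p \<in> ratpoly n" "q \<in> ratpoly n"
        "\<forall>y\<in>V \<inter> U. q y \<noteq> 0 \<and> f y = p y / q y"
      using R x by auto
    let ?W = "V \<inter> {y. length y = n \<and> q y \<noteq> 0}"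
    have o: "openin (zariski n) ?W" using V(1) openin_zariski_nonzero[OF V(4)] by (rule openin_Int)
    have g: "(\<lambda>y. p y / q y) \<in> regular (affine_space n) ?W"
      unfolding regular_affine_space_iff
      by (rule ballI, rule exI[of _ ?W], rule exI[of _ p], rule exI[of _ q]) (use o V in auto)
    have "x \<in> ?W" using V x openin_subset[OF V(1)] by auto
    then show "\<exists>V g. openin (top_of (affine_space n)) V \<and> x \<in> V \<inter> S \<and>
        g \<in> regular (affine_space n) V \<and> (\<forall>y\<in>V \<inter> U. f y = g y)"
      by (intro exI[of _ ?W] exI[of _ "\<lambda>y. p y / q y"]) (use o g V R x in auto)
  qed
qed

lemma regular_quasi_affineE:
  assumes "f \<in> regular (induced (affine_space n) S) U" "x \<in> U"
  obtains V p q where "openin (zariski n) V" "x \<in> V" "p \<in> ratpoly n" "q \<in> ratpoly n"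
    "\<forall>y\<in>V \<inter> U. q y \<noteq> 0 \<and> f y = p y / q y"
proof -
  obtain V p q where *: "openin (zariski n) V \<and> x \<in> V \<and> p \<in> ratpoly n \<and> q \<in> ratpoly n \<and>
                        (\<forall>y\<in>V \<inter> U. q y \<noteq> 0 \<and> f y = p y / q y)"
    using assms(1)[unfolded regular_quasi_affine, THEN conjunct2, rule_format, OF assms(2)]
    by (elim exE)
  show thesis by (rule that[of V p q]) (use * in auto)
qed

lemma regular_ratpoly:
  assumes "U \<subseteq> S" "U \<subseteq> {x. length x = n}" "p \<in> ratpoly n"
  shows "p \<in> regular (induced (affine_space n) S) U"
  unfolding regular_quasi_affine
proof (intro conjI ballI)
  show "U \<subseteq> S" by fact
  fix x assume "x \<in> U"
  then show "\<exists>V p' q. openin (zariski n) V \<and> x \<in> V \<and> p' \<in> ratpoly n \<and> q \<in> ratpoly n \<and>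
                        (\<forall>y\<in>V \<inter> U. q y \<noteq> 0 \<and> p y = p' y / q y)"
    using assms ratpoly_1 openin_zariski_nonzero[OF ratpoly_1, of n]
    by (intro exI[of _ "{x. length x = n}"] exI[of _ p] exI[of _ "\<lambda>x. 1"]) auto
qed

lemma regular_quasi_affine_combine:
  assumes f: "f \<in> regular (induced (affine_space n) S) U"
    and g: "g \<in> regular (induced (affine_space n) S) U"
    and c: "\<And>p q r s. p \<in> ratpoly n \<Longrightarrow> q \<in> ratpoly n \<Longrightarrow> r \<in> ratpoly n \<Longrightarrow> s \<in> ratpoly n \<Longrightarrow>
      \<exists>t u. t \<in> ratpoly n \<and> u \<in> ratpoly n \<and> (\<forall>y\<in>U. q y \<noteq> 0 \<longrightarrow> s y \<noteq> 0 \<longrightarrow>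
        f y = p y / q y \<longrightarrow> g y = r y / s y \<longrightarrow> u y \<noteq> 0 \<and> h y = t y / u y)"
  shows "h \<in> regular (induced (affine_space n) S) U"
  unfolding regular_quasi_affine
proof (intro conjI ballI)
  show "U \<subseteq> S" using f by (simp add: regular_quasi_affine)
  fix x assume x: "x \<in> U"
  obtain V p q where V: "openin (zariski n) V" "x \<in> V" "p \<in> ratpoly n" "q \<in> ratpoly n"
      "\<forall>y\<in>V \<inter> U. q y \<noteq> 0 \<and> f y = p y / q y"
    using f x by (rule regular_quasi_affineE) blast
  obtain W r s where W: "openin (zariski n) W" "x \<in> W" "r \<in> ratpoly n" "s \<in> ratpoly n"
      "\<forall>y\<in>W \<inter> U. s y \<noteq> 0 \<and> g y = r y / s y"
    using g x by (rule regular_quasi_affineE) blast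
  obtain t u where t: "t \<in> ratpoly n" "u \<in> ratpoly n" "\<forall>y\<in>U. q y \<noteq> 0 \<longrightarrow> s y \<noteq> 0 \<longrightarrow>
        f y = p y / q y \<longrightarrow> g y = r y / s y \<longrightarrow> u y \<noteq> 0 \<and> h y = t y / u y"
    using c[OF V(3,4) W(3,4)] by blast
  have "openin (zariski n) (V \<inter> W)" using V W by auto
  then show "\<exists>V p q. openin (zariski n) V \<and> x \<in> V \<and> p \<in> ratpoly n \<and> q \<in> ratpoly n \<and>
                        (\<forall>y\<in>V \<inter> U. q y \<noteq> 0 \<and> h y = p y / q y)"
    using V W t by (intro exI[of _ "V \<inter> W"] exI[of _ t] exI[of _ u]) auto
qed

lemma regular_add:
  assumes "f \<in> regular (induced (affine_space n) S) U" "g \<in> regular (induced (affine_space n) S) U"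
  shows "(\<lambda>x. f x + g x) \<in> regular (induced (affine_space n) S) U"
  using assms
proof (rule regular_quasi_affine_combine)
  fix p q r s assume pq: "p \<in> ratpoly n" "q \<in> ratpoly n" "r \<in> ratpoly n" "s \<in> ratpoly n"
  show "\<exists>t u. t \<in> ratpoly n \<and> u \<in> ratpoly n \<and> (\<forall>y\<in>U. q y \<noteq> 0 \<longrightarrow> s y \<noteq> 0 \<longrightarrow>
        f y = p y / q y \<longrightarrow> g y = r y / s y \<longrightarrow> u y \<noteq> 0 \<and> f y + g y = t y / u y)"
    by (rule exI[of _ "\<lambda>y. p y * s y + r y * q y"], rule exI[of _ "\<lambda>y. q y * s y"])
      (use pq in \<open>auto intro!: ratpoly.intros simp: field_simps\<close>)
qed

lemma regular_mult:
  assumes "f \<in> regular (induced (affine_space n) S) U" "g \<in> regular (induced (affine_space n) S) U"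
  shows "(\<lambda>x. f x * g x) \<in> regular (induced (affine_space n) S) U"
  using assms
proof (rule regular_quasi_affine_combine)
  fix p q r s assume pq: "p \<in> ratpoly n" "q \<in> ratpoly n" "r \<in> ratpoly n" "s \<in> ratpoly n"
  show "\<exists>t u. t \<in> ratpoly n \<and> u \<in> ratpoly n \<and> (\<forall>y\<in>U. q y \<noteq> 0 \<longrightarrow> s y \<noteq> 0 \<longrightarrow>
        f y = p y / q y \<longrightarrow> g y = r y / s y \<longrightarrow> u y \<noteq> 0 \<and> f y * g y = t y / u y)"
    by (rule exI[of _ "\<lambda>y. p y * r y"], rule exI[of _ "\<lambda>y. q y * s y"])
      (use pq in \<open>auto intro!: ratpoly.intros\<close>)
qed

lemma regular_divide:
  assumes "f \<in> regular (induced (affine_space n) S) U" "g \<in> regular (induced (affine_space n) S) U"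
    and nz: "\<And>x. x \<in> U \<Longrightarrow> g x \<noteq> 0"
  shows "(\<lambda>x. f x / g x) \<in> regular (induced (affine_space n) S) U"
  using assms(1,2)
proof (rule regular_quasi_affine_combine)
  fix p q r s assume pq: "p \<in> ratpoly n" "q \<in> ratpoly n" "r \<in> ratpoly n" "s \<in> ratpoly n"
  show "\<exists>t u. t \<in> ratpoly n \<and> u \<in> ratpoly n \<and> (\<forall>y\<in>U. q y \<noteq> 0 \<longrightarrow> s y \<noteq> 0 \<longrightarrow>
        f y = p y / q y \<longrightarrow> g y = r y / s y \<longrightarrow> u y \<noteq> 0 \<and> f y / g y = t y / u y)"
  proof (rule exI[of _ "\<lambda>y. p y * s y"], rule exI[of _ "\<lambda>y. q y * r y"], intro conjI ballI impI)
    fix y assume y: "y \<in> U" "q y \<noteq> 0" "s y \<noteq> 0" "f y = p y / q y" "g y = r y / s y"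
    with nz[of y] show "q y * r y \<noteq> 0" by auto
    show "f y / g y = p y * s y / (q y * r y)" using y(4,5) by simp
  qed (use pq in \<open>auto intro!: ratpoly.intros\<close>)
qed

lemma regular_comp_ratpoly:
  assumes "\<And>i. i < m \<Longrightarrow> (\<lambda>x. \<phi> x ! i) \<in> regular (induced (affine_space n) S) U"
    and "r \<in> ratpoly m" "U \<subseteq> S" "U \<subseteq> {x. length x = n}"
  shows "(\<lambda>x. r (\<phi> x)) \<in> regular (induced (affine_space n) S) U"
  using assms(2)
proof induction
  case (const c)
  show ?case using assms by (intro regular_ratpoly ratpoly.const)
qed (use assms in \<open>auto intro: regular_add regular_mult\<close>)

lemma openin_regular_nonzero:
  assumes f: "f \<in> regular (induced (affine_space n) S) U"
    and U: "openin (subtopology (zariski n) S) U"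
  shows "openin (subtopology (zariski n) S) {x \<in> U. f x \<noteq> 0}"
proof (subst openin_subopen, intro ballI)
  fix x assume x: "x \<in> {x \<in> U. f x \<noteq> 0}"
  then have xU: "x \<in> U" by simp
  obtain V p q where V: "openin (zariski n) V" "x \<in> V" "p \<in> ratpoly n"
      "\<forall>y\<in>V \<inter> U. q y \<noteq> 0 \<and> f y = p y / q y"
    using f xU by (rule regular_quasi_affineE) blast
  let ?T = "(V \<inter> {y. length y = n \<and> p y \<noteq> 0}) \<inter> U"
  have "openin (zariski n) (V \<inter> {y. length y = n \<and> p y \<noteq> 0})"
    using V(1) openin_zariski_nonzero[OF V(3)] by (rule openin_Int)
  then have "openin (subtopology (zariski n) S) ?T"
    using U by (auto simp: openin_subtopology)
  moreover have "x \<in> ?T" using x V openin_subset[OF V(1)] by auto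
  moreover have "?T \<subseteq> {x \<in> U. f x \<noteq> 0}" using V(4) by auto
  ultimately show "\<exists>T. openin (subtopology (zariski n) S) T \<and> x \<in> T \<and> T \<subseteq> {x \<in> U. f x \<noteq> 0}" by blast
qed

lemma regular_local:
  assumes "function_sheaf X" "\<And>x. x \<in> U \<Longrightarrow> \<exists>V. openin (top_of X) V \<and> x \<in> V \<and> V \<subseteq> U \<and> f \<in> regular X V"
  shows "f \<in> regular X U"
proof -
  let ?\<U> = "{V. openin (top_of X) V \<and> V \<subseteq> U \<and> f \<in> regular X V}"
  have "f \<in> regular X (\<Union>?\<U>)"
    by (rule assms(1)[unfolded function_sheaf_def, THEN conjunct2, THEN conjunct2, rule_format]) blast
  moreover have "\<Union>?\<U> = U" using assms(2) by blast
  ultimately show ?thesis by simp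
qed

text \<open>Morphisms between subsets of affine spaces are given by regular coordinate functions.\<close>

lemma morphism_quasi_affine:
  assumes S: "S \<subseteq> {x. length x = n}" and T: "T \<subseteq> {x. length x = m}"
    and im: "\<And>x. x \<in> S \<Longrightarrow> \<phi> x \<in> T"
    and co: "\<And>i. i < m \<Longrightarrow> (\<lambda>x. \<phi> x ! i) \<in> regular (induced (affine_space n) S) S"
  shows "morphism (induced (affine_space n) S) (induced (affine_space m) T) \<phi>"
proof -
  let ?X = "induced (affine_space n) S"
  have sh: "function_sheaf ?X" by (intro function_sheaf_induced function_sheaf_affine_space)
  have oS: "openin (subtopology (zariski n) S) S" using S by (simp add: openin_subtopology_refl)
  have pull: "openin (subtopology (zariski n) S) {x \<in> S. \<phi> x \<in> V}" if V: "openin (zariski m) V" for V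
  proof -
    obtain P where P: "P \<subseteq> ratpoly m" "V = {x. length x = m \<and> (\<exists>p\<in>P. p x \<noteq> 0)}"
      using V unfolding openin_zariski by blast
    have "{x \<in> S. \<phi> x \<in> V} = (\<Union>p\<in>P. {x \<in> S. p (\<phi> x) \<noteq> 0})"
      using im T unfolding P(2) by auto
    moreover have "openin (subtopology (zariski n) S) {x \<in> S. p (\<phi> x) \<noteq> 0}" if "p \<in> P" for p
    proof (rule openin_regular_nonzero[OF _ oS])
      show "(\<lambda>x. p (\<phi> x)) \<in> regular ?X S"
        by (rule regular_comp_ratpoly[OF co]) (use P(1) that S in auto)
    qed
    ultimately show ?thesis by auto
  qed
  have ps: "topspace (subtopology (zariski n) S) = S" "topspace (subtopology (zariski m) T) = T"
    using S T by auto
  have cont: "continuous_map (subtopology (zariski n) S) (subtopology (zariski m) T) \<phi>"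
  proof -
    have "{x \<in> S. \<phi> x \<in> V \<inter> T} = {x \<in> S. \<phi> x \<in> V}" for V using im by auto
    then show ?thesis
      unfolding continuous_map_def ps using im pull by (auto simp: openin_subtopology Pi_def)
  qed
  have "f \<circ> \<phi> \<in> regular ?X {x \<in> S. \<phi> x \<in> V}"
    if V: "openin (subtopology (zariski m) T) V" and f: "f \<in> regular (induced (affine_space m) T) V" for V f
  proof (rule regular_local[OF sh])
    let ?U = "{x \<in> S. \<phi> x \<in> V}"
    fix x assume x: "x \<in> ?U"
    then have xV: "\<phi> x \<in> V" by simp
    obtain W p q where W: "openin (zariski m) W" "\<phi> x \<in> W" "p \<in> ratpoly m" "q \<in> ratpoly m"
      "\<forall>y\<in>W \<inter> V. q y \<noteq> 0 \<and> f y = p y / q y"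
      using f xV by (rule regular_quasi_affineE) blast
    let ?N = "{x \<in> S. \<phi> x \<in> W} \<inter> ?U"
    have oU: "openin (subtopology (zariski n) S) ?U"
      using openin_continuous_map_preimage[OF cont V] by (simp only: ps)
    have o: "openin (subtopology (zariski n) S) ?N"
      using pull[OF W(1)] oU by (rule openin_Int)
    have NS: "?N \<subseteq> S" by auto
    have co': "(\<lambda>x. \<phi> x ! i) \<in> regular ?X ?N" if "i < m" for i
      using function_sheafD(2)[OF sh, of S ?N] co[OF that] oS o NS by simp
    have Nn: "?N \<subseteq> {x. length x = n}" using S by auto
    have "(\<lambda>x. p (\<phi> x) / q (\<phi> x)) \<in> regular ?X ?N"
    proof (rule regular_divide)
      show "(\<lambda>x. p (\<phi> x)) \<in> regular ?X ?N" "(\<lambda>x. q (\<phi> x)) \<in> regular ?X ?N"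
        by (rule regular_comp_ratpoly[OF co' _ NS Nn], use W in auto)+
    qed (use W in auto)
    then have "f \<circ> \<phi> \<in> regular ?X ?N"
      by (rule function_sheafD(1)[OF sh, rotated]) (use o W(5) in auto)
    then show "\<exists>N. openin (top_of ?X) N \<and> x \<in> N \<and> N \<subseteq> ?U \<and> f \<circ> \<phi> \<in> regular ?X N"
      using o x W(2) by (intro exI[of _ ?N]) auto
  qed
  then show ?thesis using cont ps unfolding morphism_def by auto
qed

lemma morphism_quasi_affine_coord:
  assumes m: "morphism (induced (affine_space n) S) (induced (affine_space m) T) \<phi>"
    and S: "S \<subseteq> {x. length x = n}" and T: "T \<subseteq> {x. length x = m}" and i: "i < m"
  shows "(\<lambda>x. \<phi> x ! i) \<in> regular (induced (affine_space n) S) S"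
proof -
  have "openin (subtopology (zariski m) T) T" using T by (simp add: openin_subtopology_refl)
  moreover have "(\<lambda>x. x ! i) \<in> regular (induced (affine_space m) T) T"
    using T i by (intro regular_ratpoly ratpoly.coord) auto
  ultimately have "(\<lambda>x. x ! i) \<circ> \<phi> \<in> regular (induced (affine_space n) S)
      {x \<in> points (induced (affine_space n) S). \<phi> x \<in> T}"
    using m unfolding morphism_def by auto
  moreover have "{x \<in> points (induced (affine_space n) S). \<phi> x \<in> T} = S"
  proof -
    have "\<phi> ` points (induced (affine_space n) S) \<subseteq> T"
      using continuous_map_image_subset_topspace[of "subtopology (zariski n) S" "subtopology (zariski m) T" \<phi>] m
      by (auto simp: morphism_def)
    moreover have "points (induced (affine_space n) S) = S" using S by auto
    ultimately show ?thesis by auto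
  qed
  ultimately show ?thesis by (simp add: comp_def)
qed

lemma separated_quasi_affine:
  assumes T: "T \<subseteq> {x. length x = m}"
  shows "separated_space (induced (affine_space m) T)"
  unfolding separated_space_def
proof (intro allI impI, elim conjE)
  fix n C \<phi> \<psi>
  assume C: "closedin (zariski n) C"
    and \<phi>: "morphism (induced (affine_space n) C) (induced (affine_space m) T) \<phi>"
    and \<psi>: "morphism (induced (affine_space n) C) (induced (affine_space m) T) \<psi>"
  have CS: "C \<subseteq> {x. length x = n}" using closedin_subset[OF C] by simp
  have oC: "openin (subtopology (zariski n) C) C" using CS by (simp add: openin_subtopology_refl)
  have im: "\<phi> x \<in> T" "\<psi> x \<in> T" if "x \<in> C" for x
    using \<phi> \<psi> that CS by (auto simp: morphism_def continuous_map_def Pi_def)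
  have "openin (subtopology (zariski n) C) {x \<in> C. \<phi> x ! i - \<psi> x ! i \<noteq> 0}" if i: "i < m" for i
  proof -
    have "(\<lambda>x. - 1) \<in> regular (induced (affine_space n) C) C"
      using CS ratpoly_uminus[OF ratpoly_1] by (intro regular_ratpoly) auto
    then have "(\<lambda>x. \<phi> x ! i + - 1 * \<psi> x ! i) \<in> regular (induced (affine_space n) C) C"
      using CS T i \<phi> \<psi> by (intro regular_add regular_mult morphism_quasi_affine_coord) auto
    then have "openin (subtopology (zariski n) C) {x \<in> C. \<phi> x ! i + - 1 * \<psi> x ! i \<noteq> 0}"
      using oC by (rule openin_regular_nonzero)
    then show ?thesis by simp
  qed
  then have "openin (subtopology (zariski n) C) (\<Union>i\<in>{..<m}. {x \<in> C. \<phi> x ! i - \<psi> x ! i \<noteq> 0})"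
    by auto
  moreover have "(\<Union>i\<in>{..<m}. {x \<in> C. \<phi> x ! i - \<psi> x ! i \<noteq> 0}) = C - {x \<in> C. \<phi> x = \<psi> x}"
  proof -
    have "\<phi> x = \<psi> x \<longleftrightarrow> (\<forall>i<m. \<phi> x ! i = \<psi> x ! i)" if "x \<in> C" for x
    proof -
      have "length (\<phi> x) = m" "length (\<psi> x) = m" using im[OF that] T by auto
      then show ?thesis by (simp add: list_eq_iff_nth_eq)
    qed
    then show ?thesis by auto
  qed
  moreover have "topspace (subtopology (zariski n) C) = C" using CS by auto
  ultimately have "closedin (subtopology (zariski n) C) {x \<in> C. \<phi> x = \<psi> x}"
    unfolding closedin_def by auto
  then show "closedin (zariski n) {x \<in> C. \<phi> x = \<psi> x}"
    using C by (rule closedin_trans_full)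
qed

lemma ratpoly_take: "p \<in> ratpoly n \<Longrightarrow> (\<lambda>x. p (take n x)) \<in> ratpoly (Suc n)"
  by (induction rule: ratpoly.induct) (auto intro: ratpoly.intros)

text \<open>A basic open subset of a closed subset is affine (Rabinowitsch).\<close>

lemma affine_variety_basic_open:
  assumes C: "closedin (zariski n) C" and q: "q \<in> ratpoly n"
  shows "affine_variety (induced (affine_space n) (C \<inter> {x. q x \<noteq> 0}))"
proof -
  have CS: "C \<subseteq> {x. length x = n}" using closedin_subset[OF C] by simp
  let ?A = "C \<inter> {x. q x \<noteq> 0}"
  let ?B = "{y. length y = Suc n \<and> take n y \<in> C \<and> q (take n y) * y ! n = 1}"
  obtain P where P: "P \<subseteq> ratpoly n" "{x. length x = n} - C = {x. length x = n \<and> (\<exists>p\<in>P. p x \<noteq> 0)}"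
    using C unfolding closedin_def openin_zariski by auto
  have Ceq: "x \<in> C \<longleftrightarrow> (\<forall>p\<in>P. p x = 0)" if "length x = n" for x
    using P(2) that by auto
  let ?Q = "insert (\<lambda>y. q (take n y) * y ! n - 1) ((\<lambda>p y. p (take n y)) ` P)"
  have "?Q \<subseteq> ratpoly (Suc n)"
    using P(1) q by (auto intro!: ratpoly_take ratpoly_diff ratpoly_1 ratpoly.mult ratpoly.coord)
  moreover have "{y. length y = Suc n} - ?B = {y. length y = Suc n \<and> (\<exists>p\<in>?Q. p y \<noteq> 0)}"
    using Ceq by auto
  ultimately have "openin (zariski (Suc n)) ({y. length y = Suc n} - ?B)"
    unfolding openin_zariski by blast
  then have B: "closedin (zariski (Suc n)) ?B" unfolding closedin_def by auto
  have AS: "?A \<subseteq> {x. length x = n}" and BS: "?B \<subseteq> {x. length x = Suc n}" using CS by auto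
  have "morphism (induced (affine_space n) ?A) (induced (affine_space (Suc n)) ?B) (\<lambda>x. x @ [1 / q x])"
  proof (rule morphism_quasi_affine[OF AS BS])
    show "x @ [1 / q x] \<in> ?B" if "x \<in> ?A" for x using that CS by (auto simp: nth_append)
    fix i assume i: "i < Suc n"
    have sh: "function_sheaf (induced (affine_space n) ?A)"
      by (intro function_sheaf_induced function_sheaf_affine_space)
    have oA: "openin (top_of (induced (affine_space n) ?A)) ?A"
      using AS by (simp add: openin_subtopology_refl)
    show "(\<lambda>x. (x @ [1 / q x]) ! i) \<in> regular (induced (affine_space n) ?A) ?A"
    proof (cases "i < n")
      case True
      have "(\<lambda>x. x ! i) \<in> regular (induced (affine_space n) ?A) ?A"
        using AS True by (intro regular_ratpoly ratpoly.coord) auto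
      then show ?thesis
        by (rule function_sheafD(1)[OF sh oA]) (use True CS in \<open>auto simp: nth_append\<close>)
    next
      case False
      have "(\<lambda>x. 1 / q x) \<in> regular (induced (affine_space n) ?A) ?A"
        using AS q by (intro regular_divide regular_ratpoly ratpoly_1) auto
      then show ?thesis
        by (rule function_sheafD(1)[OF sh oA]) (use False i CS in \<open>auto simp: nth_append\<close>)
    qed
  qed
  moreover have "morphism (induced (affine_space (Suc n)) ?B) (induced (affine_space n) ?A) (take n)"
  proof (rule morphism_quasi_affine[OF BS AS])
    show "take n y \<in> ?A" if "y \<in> ?B" for y using that by auto
    fix i assume "i < n"
    then show "(\<lambda>y. take n y ! i) \<in> regular (induced (affine_space (Suc n)) ?B) ?B"
      by (intro regular_ratpoly) (auto intro: ratpoly.coord)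
  qed
  moreover have "take n (x @ [1 / q x]) = x" if "x \<in> ?A" for x using that CS by auto
  moreover have "take n y @ [1 / q (take n y)] = y" if "y \<in> ?B" for y
  proof -
    have 1: "q (take n y) * y ! n = 1" using that by simp
    then have "q (take n y) \<noteq> 0" by auto
    with 1 have "1 / q (take n y) = y ! n" by (simp add: divide_eq_eq mult.commute)
    then show ?thesis using that take_Suc_conv_app_nth[of n y] by simp
  qed
  ultimately have "isomorphic (induced (affine_space n) ?A) (induced (affine_space (Suc n)) ?B)"
    unfolding isomorphic_def using AS BS
    by (intro exI[of _ "\<lambda>x. x @ [1 / q x]"] exI[of _ "take n"]) auto
  then show ?thesis unfolding affine_variety_def using B by blast
qed

lemma is_variety_quasi_affine:
  assumes C: "closedin (zariski n) C" and Q: "finite Q" "Q \<subseteq> ratpoly n"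
  shows "is_variety (induced (affine_space n) (C \<inter> {x. \<exists>q\<in>Q. q x \<noteq> 0}))"
proof -
  have CS: "C \<subseteq> {x. length x = n}" using closedin_subset[OF C] by simp
  let ?S = "C \<inter> {x. \<exists>q\<in>Q. q x \<noteq> 0}"
  let ?\<U> = "(\<lambda>q. C \<inter> {x. q x \<noteq> 0}) ` Q"
  have "openin (subtopology (zariski n) ?S) U \<and> affine_variety (induced (induced (affine_space n) ?S) U)"
    if U: "U \<in> ?\<U>" for U
  proof -
    obtain q where q: "q \<in> Q" "U = C \<inter> {x. q x \<noteq> 0}" using U by blast
    have "U = {x. length x = n \<and> q x \<noteq> 0} \<inter> ?S" using q CS by auto
    then have "openin (subtopology (zariski n) ?S) U"
      using openin_zariski_nonzero[of q n] q Q by (auto simp: openin_subtopology)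
    moreover have "induced (induced (affine_space n) ?S) U = induced (affine_space n) U"
      using q by (intro induced_induced function_sheaf_affine_space) auto
    ultimately show ?thesis using affine_variety_basic_open[OF C, of q] q Q by auto
  qed
  moreover have "\<Union>?\<U> = points (induced (affine_space n) ?S)" using CS by auto
  moreover have "separated_space (induced (affine_space n) ?S)"
    using CS by (intro separated_quasi_affine) auto
  ultimately show ?thesis
    unfolding is_variety_def using Q(1)
    by (intro conjI function_sheaf_induced function_sheaf_affine_space exI[of _ ?\<U>]) auto
qed

lemma induced_affine_space_UNIV: "induced (affine_space n) {x. length x = n} = affine_space n"
proof -
  have "regular (induced (affine_space n) {x. length x = n}) U = regular (affine_space n) U" for U
  proof -
    have "U \<subseteq> {x. length x = n}" if "\<forall>x\<in>U. \<exists>V. openin (zariski n) V \<and> x \<in> V"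
      using that openin_subset by fastforce
    then show ?thesis
      by (intro set_eqI) (simp only: regular_quasi_affine regular_affine_space_iff, meson)
  qed
  then have "regular (induced (affine_space n) {x. length x = n}) = regular (affine_space n)"
    by (rule ext)
  moreover have "top_of (induced (affine_space n) {x. length x = n}) = top_of (affine_space n)"
    using subtopology_topspace[of "zariski n"] by simp
  ultimately show ?thesis by simp
qed

lemma is_variety_affine_space: "is_variety (affine_space n)"
proof -
  have "is_variety (induced (affine_space n) ({x. length x = n} \<inter> {x. \<exists>q\<in>{\<lambda>x. 1 :: complex}. q x \<noteq> 0}))"
    by (rule is_variety_quasi_affine) (use ratpoly_1 closedin_topspace[of "zariski n"] in auto)
  then show ?thesis by (simp add: induced_affine_space_UNIV)
qed

section \<open>Products\<close>

text \<open>The product of varieties (the fibre product over the rationals, which is reduced in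
  characteristic zero), by its universal property.\<close>

definition is_product ::
    "variety \<Rightarrow> variety \<Rightarrow> variety \<Rightarrow> (complex list \<Rightarrow> complex list) \<Rightarrow> (complex list \<Rightarrow> complex list) \<Rightarrow> bool"
  where
  "is_product P X Y \<pi>\<^sub>1 \<pi>\<^sub>2 \<longleftrightarrow>
     morphism (Rep_variety P) (Rep_variety X) \<pi>\<^sub>1 \<and> morphism (Rep_variety P) (Rep_variety Y) \<pi>\<^sub>2 \<and>
     (\<forall>T \<alpha> \<beta>. morphism (Rep_variety T) (Rep_variety X) \<alpha> \<and>
              morphism (Rep_variety T) (Rep_variety Y) \<beta> \<longrightarrow>
        (\<exists>\<gamma>. morphism (Rep_variety T) (Rep_variety P) \<gamma> \<and>
             (\<forall>t\<in>points (Rep_variety T). \<pi>\<^sub>1 (\<gamma> t) = \<alpha> t \<and> \<pi>\<^sub>2 (\<gamma> t) = \<beta> t) \<and>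
             (\<forall>\<delta>. morphism (Rep_variety T) (Rep_variety P) \<delta> \<and>
                  (\<forall>t\<in>points (Rep_variety T). \<pi>\<^sub>1 (\<delta> t) = \<alpha> t \<and> \<pi>\<^sub>2 (\<delta> t) = \<beta> t) \<longrightarrow>
                  (\<forall>t\<in>points (Rep_variety T). \<delta> t = \<gamma> t))))"

section \<open>The Grothendieck ring of varieties\<close>

text \<open>The free commutative ring on symbols, one for each variety (integer polynomials in these
  symbols), modulo the ideal of the defining relations: isomorphism, scissors, \<open>[X \<times> Y] = [X] [Y]\<close>,
  and the class of the point (affine 0-space) being the unit.\<close>

type_synonym symbol_ring = "(variety \<Rightarrow>\<^sub>0 nat) \<Rightarrow>\<^sub>0 int"

definition symbol :: "variety \<Rightarrow> symbol_ring" where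
  "symbol X = Poly_Mapping.single (Poly_Mapping.single X 1) 1"

inductive_set K0_ideal :: "symbol_ring set" where
  iso: "isomorphic (Rep_variety X) (Rep_variety Y) \<Longrightarrow> symbol X - symbol Y \<in> K0_ideal"
| scissors: "closedin (top_of (Rep_variety X)) C \<Longrightarrow>
    Rep_variety Z = induced (Rep_variety X) C \<Longrightarrow>
    Rep_variety U = induced (Rep_variety X) (points (Rep_variety X) - C) \<Longrightarrow>
    symbol X - (symbol Z + symbol U) \<in> K0_ideal"
| product: "is_product P X Y \<pi>\<^sub>1 \<pi>\<^sub>2 \<Longrightarrow> symbol P - symbol X * symbol Y \<in> K0_ideal"
| point: "Rep_variety P = affine_space 0 \<Longrightarrow> symbol P - 1 \<in> K0_ideal"
| zero: "0 \<in> K0_ideal"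
| add: "a \<in> K0_ideal \<Longrightarrow> b \<in> K0_ideal \<Longrightarrow> a + b \<in> K0_ideal"
| mult: "a \<in> K0_ideal \<Longrightarrow> r * a \<in> K0_ideal"

definition K0_rel :: "symbol_ring \<Rightarrow> symbol_ring \<Rightarrow> bool" where
  "K0_rel a b \<longleftrightarrow> a - b \<in> K0_ideal"

lemma K0_ideal_uminus: "a \<in> K0_ideal \<Longrightarrow> - a \<in> K0_ideal"
  using K0_ideal.mult[of a "- 1"] by simp

lemma equivp_K0_rel: "equivp K0_rel"
proof (rule equivpI)
  show "reflp K0_rel" by (simp add: reflp_def K0_rel_def K0_ideal.zero)
  show "symp K0_rel"
  proof (rule sympI)
    fix a b :: symbol_ring
    assume "K0_rel a b"
    then show "K0_rel b a" unfolding K0_rel_def using K0_ideal_uminus[of "a - b"] by simp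
  qed
  show "transp K0_rel"
    unfolding transp_def K0_rel_def
  proof (intro allI impI)
    fix a b c :: symbol_ring
    assume "a - b \<in> K0_ideal" "b - c \<in> K0_ideal"
    then have "(a - b) + (b - c) \<in> K0_ideal" by (rule K0_ideal.add)
    then show "a - c \<in> K0_ideal" by simp
  qed
qed

quotient_type K0 = symbol_ring / K0_rel
  by (rule equivp_K0_rel)

text \<open>The class \<open>comm_ring_1\<close> would require a proof that the ring is not trivial; the numerals
  and powers below only need the two classes instantiated here.\<close>

instantiation K0 :: "{comm_ring, comm_monoid_mult}"
begin

lift_definition zero_K0 :: K0 is 0 .
lift_definition one_K0 :: K0 is 1 .
lift_definition plus_K0 :: "K0 \<Rightarrow> K0 \<Rightarrow> K0" is "(+)"
proof -
  fix a b c d :: symbol_ring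
  assume "K0_rel a b" "K0_rel c d"
  then have "(a - b) + (c - d) \<in> K0_ideal"
    unfolding K0_rel_def by (intro K0_ideal.add)
  then show "K0_rel (a + c) (b + d)" unfolding K0_rel_def by (simp add: algebra_simps)
qed
lift_definition uminus_K0 :: "K0 \<Rightarrow> K0" is uminus
proof -
  fix a b :: symbol_ring
  assume "K0_rel a b"
  then have "- (a - b) \<in> K0_ideal" unfolding K0_rel_def by (rule K0_ideal_uminus)
  then show "K0_rel (- a) (- b)" unfolding K0_rel_def by simp
qed
lift_definition minus_K0 :: "K0 \<Rightarrow> K0 \<Rightarrow> K0" is "(-)"
proof -
  fix a b c d :: symbol_ring
  assume "K0_rel a b" "K0_rel c d"
  then have "(a - b) + - (c - d) \<in> K0_ideal"
    unfolding K0_rel_def by (intro K0_ideal.add K0_ideal_uminus)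
  then show "K0_rel (a - c) (b - d)" unfolding K0_rel_def by (simp add: algebra_simps)
qed
lift_definition times_K0 :: "K0 \<Rightarrow> K0 \<Rightarrow> K0" is "(*)"
proof -
  fix a b c d :: symbol_ring
  assume "K0_rel a b" "K0_rel c d"
  then have "c * (a - b) + b * (c - d) \<in> K0_ideal"
    unfolding K0_rel_def by (intro K0_ideal.add K0_ideal.mult)
  then show "K0_rel (a * c) (b * d)" unfolding K0_rel_def by (simp add: algebra_simps)
qed

instance
proof
  fix a b c :: K0
  have refl: "K0_rel x x" for x by (simp add: K0_rel_def K0_ideal.zero)
  show "a + b + c = a + (b + c)" by transfer (simp add: refl add.assoc)
  show "a + b = b + a" by transfer (simp add: refl add.commute)
  show "0 + a = a" by transfer (simp add: refl)
  show "- a + a = 0" by transfer (simp add: refl)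
  show "a - b = a + - b" by transfer (simp add: refl)
  show "a * b * c = a * (b * c)" by transfer (simp add: refl mult.assoc)
  show "a * b = b * a" by transfer (simp add: refl mult.commute)
  show "1 * a = a" by transfer (simp add: refl)
  show "(a + b) * c = a * c + b * c" by transfer (simp add: refl distrib_right)
qed

end

instance K0 :: numeral ..

lift_definition K0_class :: "variety \<Rightarrow> K0" is symbol .

text \<open>The class of a locally closed subset, defined over the rationals, of affine \<open>n\<close>-space.  That
  the arguments of \<open>Abs_variety\<close> are varieties is \<open>is_variety_quasi_affine\<close>,
  \<open>is_variety_affine_space\<close> and, for the set of interest, \<open>is_variety_Sigma_minus_det\<close>.\<close>

definition class_of :: "nat \<Rightarrow> complex list set \<Rightarrow> K0" where
  "class_of n S = K0_class (Abs_variety (induced (affine_space n) S))"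

definition lefschetz :: K0 ("\<bbbL>") where
  "\<bbbL> = K0_class (Abs_variety (affine_space 1))"

section \<open>The determinant hypersurface and the normal crossings divisor\<close>

definition matrix_of :: "complex list \<Rightarrow> complex^3^3" where
  "matrix_of x = vector [vector [x!0, x!1, x!2], vector [x!3, x!4, x!5], vector [x!6, x!7, x!8]]"

definition det_hypersurface :: "complex list set" where
  "det_hypersurface = {x. length x = 9 \<and> det (matrix_of x) = 0}"

definition divisor_Sigma :: "complex list set" where
  "divisor_Sigma = {x. length x = 9 \<and>
     (let m = matrix_of x in
        m$1$2 * m$1$3 * m$2$3 * (m$1$1 + m$1$2 + m$1$3) *
        (m$2$1 + m$2$2 + m$2$3) * (m$3$1 + m$3$2 + m$3$3) = 0)}"

lemma ratpoly_matrix_entry: "(\<lambda>x. matrix_of x $ i $ j) \<in> ratpoly 9"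
  using exhaust_3[of i] exhaust_3[of j] by (auto simp: matrix_of_def intro!: ratpoly.coord)

lemma is_variety_Sigma_minus_det:
  "is_variety (induced (affine_space 9) (divisor_Sigma - (det_hypersurface \<inter> divisor_Sigma)))"
proof -
  have d: "(\<lambda>x. det (matrix_of x)) \<in> ratpoly 9"
    unfolding det_3 by (intro ratpoly.intros ratpoly_diff ratpoly_matrix_entry)
  have "closedin (zariski 9) divisor_Sigma"
    unfolding divisor_Sigma_def Let_def
    by (intro closedin_zariski_zero ratpoly.intros ratpoly_matrix_entry)
  then have "is_variety (induced (affine_space 9)
      (divisor_Sigma \<inter> {x. \<exists>q\<in>{\<lambda>x. det (matrix_of x)}. q x \<noteq> 0}))"
    using d by (intro is_variety_quasi_affine) auto
  moreover have "divisor_Sigma \<inter> {x. \<exists>q\<in>{\<lambda>x. det (matrix_of x)}. q x \<noteq> 0}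
      = divisor_Sigma - (det_hypersurface \<inter> divisor_Sigma)"
    by (auto simp: det_hypersurface_def divisor_Sigma_def)
  ultimately show ?thesis by simp
qed

end

theory Submission
  imports Defs
begin

text \<open>
  Adding the second and third columns of a matrix to the first preserves the determinant and turns
  the divisor into a union of six coordinate hyperplanes, one for each entry of the first row, the
  first column and the position \<open>(2,3)\<close> (lemma \<open>class_of_Sigma_minus_det\<close>).  By the scissors
  relation the class is then \<open>[GL3] - [U]\<close>, where \<open>U\<close> consists of the invertible matrices for
  which these six entries are nonzero.

  Both terms reduce to \<open>2 \<times> 2\<close> matrices.  Stratify \<open>GL3\<close> by the first nonzero entry of the
  first column and clear that column: each stratum is a torus times an affine space times \<open>GL2\<close>,
  and together they give \<open>[GL3] = (L - 1) (L^2 + L^3 + L^4) [GL2]\<close>; the same method gives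
  \<open>[GL2] = (L - 1)^2 (L + L^2)\<close>.  In \<open>U\<close>, scale the rows and columns until the first row and
  column consist of ones, and subtract the first row from the others: \<open>U\<close> is a torus of dimension
  five times the set \<open>V\<close> of the matrices in \<open>GL2\<close> whose upper right entry differs from \<open>-1\<close>,
  and \<open>[V] = [GL2] - (L - 1) L^2\<close>.

  The relations of the Grothendieck ring enter through three rules for subsets of affine space:
  \<open>class_of_scissors\<close>, \<open>class_of_coordinates\<close> (mutually inverse maps with regular coordinates) and
  \<open>class_of_list_prod\<close> (concatenation of lists is the product).  The last one needs an argument,
  because products are characterised by a universal property that quantifies over all varieties:
  a map from an arbitrary variety to a subset of affine space has to be recognised as a morphism by
  its coordinates (\<open>morphism_to_quasi_affine\<close>).
\<close>

section \<open>Morphisms from a variety to a subset of affine space\<close>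

lemma morphism_in:
  assumes "morphism X Y \<phi>" "x \<in> points X"
  shows "\<phi> x \<in> points Y"
  using assms by (auto simp: morphism_def continuous_map_def Pi_def)

lemma morphism_regular:
  assumes "morphism X Y \<phi>" "openin (top_of Y) V" "f \<in> regular Y V"
  shows "f \<circ> \<phi> \<in> regular X {x \<in> points X. \<phi> x \<in> V}"
  using assms unfolding morphism_def by blast

lemma morphism_comp:
  assumes \<phi>: "morphism X Y \<phi>" and \<psi>: "morphism Y Z \<psi>"
  shows "morphism X Z (\<psi> \<circ> \<phi>)"
  unfolding morphism_def
proof (intro conjI allI impI; (elim conjE)?)
  show "continuous_map (top_of X) (top_of Z) (\<psi> \<circ> \<phi>)"
    using \<phi> \<psi> unfolding morphism_def by (blast intro: continuous_map_compose)
  fix V f assume V: "openin (top_of Z) V" and f: "f \<in> regular Z V"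
  let ?W = "{y \<in> points Y. \<psi> y \<in> V}"
  have "openin (top_of Y) ?W"
    using \<psi> V unfolding morphism_def by (blast intro: openin_continuous_map_preimage)
  then have "(f \<circ> \<psi>) \<circ> \<phi> \<in> regular X {x \<in> points X. \<phi> x \<in> ?W}"
    using morphism_regular[OF \<psi> V f] by (rule morphism_regular[OF \<phi>])
  moreover have "{x \<in> points X. \<phi> x \<in> ?W} = {x \<in> points X. (\<psi> \<circ> \<phi>) x \<in> V}"
    using morphism_in[OF \<phi>] by auto
  ultimately show "f \<circ> (\<psi> \<circ> \<phi>) \<in> regular X {x \<in> points X. (\<psi> \<circ> \<phi>) x \<in> V}"
    by (simp add: comp_assoc)
qed

lemma morphism_cong:
  assumes sh: "function_sheaf X" and \<phi>: "morphism X Y \<phi>"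
    and e: "\<And>x. x \<in> points X \<Longrightarrow> \<phi> x = \<psi> x"
  shows "morphism X Y \<psi>"
  unfolding morphism_def
proof (intro conjI allI impI; (elim conjE)?)
  show "continuous_map (top_of X) (top_of Y) \<psi>"
    using \<phi> e unfolding morphism_def by (blast intro: continuous_map_eq)
  fix V f assume V: "openin (top_of Y) V" and f: "f \<in> regular Y V"
  let ?U = "{x \<in> points X. \<phi> x \<in> V}"
  have U: "openin (top_of X) ?U"
    using \<phi> V unfolding morphism_def by (blast intro: openin_continuous_map_preimage)
  have "f \<circ> \<psi> \<in> regular X ?U"
    by (rule function_sheafD(1)[OF sh U morphism_regular[OF \<phi> V f]]) (use e in auto)
  moreover have "?U = {x \<in> points X. \<psi> x \<in> V}" using e by auto
  ultimately show "f \<circ> \<psi> \<in> regular X {x \<in> points X. \<psi> x \<in> V}" by simp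
qed

text \<open>For \<open>W\<close> open in the ambient space, the local extensions that define the induced sheaf can be
  restricted to \<open>W\<close> itself and glued.\<close>

lemma regular_induced_open_iff:
  assumes sh: "function_sheaf X" and W: "openin (top_of X) W" "W \<subseteq> S"
  shows "f \<in> regular (induced X S) W \<longleftrightarrow> f \<in> regular X W"
proof
  assume f: "f \<in> regular (induced X S) W"
  show "f \<in> regular X W"
  proof (rule regular_local[OF sh])
    fix x assume x: "x \<in> W"
    obtain V g where V: "openin (top_of X) V" "x \<in> V" "g \<in> regular X V"
        "\<And>y. y \<in> V \<Longrightarrow> y \<in> W \<Longrightarrow> f y = g y"
      using f x by (rule regular_inducedE) blast
    have o: "openin (top_of X) (V \<inter> W)" using V(1) W(1) by (rule openin_Int)
    have "g \<in> regular X (V \<inter> W)" using function_sheafD(2)[OF sh V(1) o _ V(3)] by simp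
    then have "f \<in> regular X (V \<inter> W)"
      by (rule function_sheafD(1)[OF sh o]) (use V in auto)
    then show "\<exists>V. openin (top_of X) V \<and> x \<in> V \<and> V \<subseteq> W \<and> f \<in> regular X V"
      using o x V(2) by (intro exI[of _ "V \<inter> W"]) auto
  qed
next
  assume "f \<in> regular X W"
  then show "f \<in> regular (induced X S) W"
    unfolding regular_induced_iff using W by (intro ballI exI[of _ W] exI[of _ f]) auto
qed

lemma morphism_glue:
  assumes sh: "function_sheaf X" and cov: "\<Union>\<U> = points X"
    and op: "\<And>U. U \<in> \<U> \<Longrightarrow> openin (top_of X) U"
    and mor: "\<And>U. U \<in> \<U> \<Longrightarrow> morphism (induced X U) Y \<phi>"
  shows "morphism X Y \<phi>"
proof -
  have pU: "points (induced X U) = U" if "U \<in> \<U>" for U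
    using openin_subset[OF op[OF that]] by auto
  have into: "\<phi> x \<in> points Y" if "x \<in> points X" for x
    using that cov morphism_in[OF mor] pU by blast
  have loc: "openin (top_of X) {x \<in> U. \<phi> x \<in> V}" if U: "U \<in> \<U>" and V: "openin (top_of Y) V" for U V
  proof -
    have "openin (subtopology (top_of X) U) {x \<in> points (induced X U). \<phi> x \<in> V}"
      using openin_continuous_map_preimage[OF _ V] mor[OF U] unfolding morphism_def by fastforce
    then show ?thesis using openin_trans_full[OF _ op[OF U]] unfolding pU[OF U] by blast
  qed
  have un: "{x \<in> points X. \<phi> x \<in> V} = (\<Union>U\<in>\<U>. {x \<in> U. \<phi> x \<in> V})" for V
    using cov by auto
  have pre: "openin (top_of X) {x \<in> points X. \<phi> x \<in> V}" if "openin (top_of Y) V" for V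
    unfolding un using loc[OF _ that] by blast
  have "f \<circ> \<phi> \<in> regular X {x \<in> points X. \<phi> x \<in> V}"
    if V: "openin (top_of Y) V" and f: "f \<in> regular Y V" for V f
  proof (rule regular_local[OF sh])
    fix x assume x: "x \<in> {x \<in> points X. \<phi> x \<in> V}"
    then obtain U where U: "U \<in> \<U>" "x \<in> U" using cov by blast
    have "f \<circ> \<phi> \<in> regular (induced X U) {x \<in> U. \<phi> x \<in> V}"
      using morphism_regular[OF mor[OF U(1)] V f] unfolding pU[OF U(1)] .
    then have "f \<circ> \<phi> \<in> regular X {x \<in> U. \<phi> x \<in> V}"
      using regular_induced_open_iff[OF sh loc[OF U(1) V]] by simp
    then show "\<exists>W. openin (top_of X) W \<and> x \<in> W \<and> W \<subseteq> {x \<in> points X. \<phi> x \<in> V} \<and> f \<circ> \<phi> \<in> regular X W"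
      using x U loc[OF U(1) V] un by (intro exI[of _ "{x \<in> U. \<phi> x \<in> V}"]) auto
  qed
  then show ?thesis
    unfolding morphism_def continuous_map_def using into pre by auto
qed

lemma regular_coord_of_morphism:
  assumes m: "morphism X (induced (affine_space m) T) \<phi>"
    and T: "T \<subseteq> {x. length x = m}" and i: "i < m"
  shows "(\<lambda>x. \<phi> x ! i) \<in> regular X (points X)"
proof -
  have "openin (subtopology (zariski m) T) T" using T by (simp add: openin_subtopology_refl)
  moreover have "(\<lambda>x. x ! i) \<in> regular (induced (affine_space m) T) T"
    using T i by (intro regular_ratpoly ratpoly.coord) auto
  ultimately have "(\<lambda>x. x ! i) \<circ> \<phi> \<in> regular X {x \<in> points X. \<phi> x \<in> T}"
    by (intro morphism_regular[OF m]) auto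
  moreover have "{x \<in> points X. \<phi> x \<in> T} = points X"
    using morphism_in[OF m] T by auto
  ultimately show ?thesis by (simp add: comp_def)
qed

text \<open>On each chart of an affine cover the source is a closed subset of some affine space, where regular
  coordinates are known to define a morphism; the chart is used to transport the coordinates there
  and the resulting morphism back.  The local morphisms then glue.\<close>

lemma morphism_to_quasi_affine:
  assumes X: "is_variety X" and T: "T \<subseteq> {x. length x = m}"
    and im: "\<And>x. x \<in> points X \<Longrightarrow> \<phi> x \<in> T"
    and co: "\<And>i. i < m \<Longrightarrow> (\<lambda>x. \<phi> x ! i) \<in> regular X (points X)"
  shows "morphism X (induced (affine_space m) T) \<phi>"
proof -
  have sh: "function_sheaf X" using X by (simp add: is_variety_def)
  obtain \<U> where cov: "\<Union>\<U> = points X"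
    and U: "\<And>U. U \<in> \<U> \<Longrightarrow> openin (top_of X) U" "\<And>U. U \<in> \<U> \<Longrightarrow> affine_variety (induced X U)"
    using X unfolding is_variety_def by blast
  have "morphism (induced X U) (induced (affine_space m) T) \<phi>" if "U \<in> \<U>" for U
  proof -
    let ?U = "induced X U"
    have UX: "U \<subseteq> points X" using openin_subset[OF U(1)[OF that]] .
    then have pU: "points ?U = U" by auto
    obtain k C where C: "closedin (zariski k) C" "isomorphic ?U (induced (affine_space k) C)"
      using U(2)[OF \<open>U \<in> \<U>\<close>] unfolding affine_variety_def by blast
    let ?C = "induced (affine_space k) C"
    obtain \<theta> \<eta> where \<theta>: "morphism ?U ?C \<theta>" and \<eta>: "morphism ?C ?U \<eta>"
      and inv: "\<And>x. x \<in> U \<Longrightarrow> \<eta> (\<theta> x) = x"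
      using C(2) unfolding isomorphic_def pU by blast
    have CS: "C \<subseteq> {x. length x = k}" using closedin_subset[OF C(1)] by simp
    then have pC: "points ?C = C" by auto
    have \<eta>U: "\<eta> x \<in> U" if "x \<in> C" for x using morphism_in[OF \<eta>] that pU pC by auto
    have "morphism ?C (induced (affine_space m) T) (\<phi> \<circ> \<eta>)"
    proof (rule morphism_quasi_affine[OF CS T])
      show "(\<phi> \<circ> \<eta>) x \<in> T" if "x \<in> C" for x using \<eta>U[OF that] UX im by auto
      fix i assume i: "i < m"
      have "(\<lambda>x. \<phi> x ! i) \<in> regular X U"
        using function_sheafD(2)[OF sh openin_topspace U(1)[OF \<open>U \<in> \<U>\<close>] UX co[OF i]] .
      then have "(\<lambda>x. \<phi> x ! i) \<in> regular ?U U"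
        using regular_induced_open_iff[OF sh U(1)[OF that]] by blast
      then have "(\<lambda>x. \<phi> x ! i) \<circ> \<eta> \<in> regular ?C {x \<in> points ?C. \<eta> x \<in> U}"
        using U(1)[OF that] UX by (intro morphism_regular[OF \<eta>]) (auto simp: openin_subtopology_refl)
      moreover have "{x \<in> points ?C. \<eta> x \<in> U} = C" using \<eta>U unfolding pC by auto
      ultimately show "(\<lambda>x. (\<phi> \<circ> \<eta>) x ! i) \<in> regular ?C C" by (simp add: comp_def)
    qed
    then have "morphism ?U (induced (affine_space m) T) ((\<phi> \<circ> \<eta>) \<circ> \<theta>)"
      by (rule morphism_comp[OF \<theta>])
    then show ?thesis
      by (rule morphism_cong[OF function_sheaf_induced[OF sh]]) (use inv pU in auto)
  qed
  then show ?thesis using morphism_glue[OF sh cov U(1)] by blast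
qed

section \<open>Classes of locally closed subsets of affine space\<close>

text \<open>A single inequation instead of a general open set is enough for every set below, and it makes the
  class closed under intersections by multiplying the two polynomials.\<close>

definition quasi_affine :: "nat \<Rightarrow> complex list set \<Rightarrow> bool" where
  "quasi_affine n S \<longleftrightarrow>
     (\<exists>C q. closedin (zariski n) C \<and> q \<in> ratpoly n \<and> S = C \<inter> {x. q x \<noteq> 0})"

lemma quasi_affine_length: "quasi_affine n S \<Longrightarrow> S \<subseteq> {x. length x = n}"
  unfolding quasi_affine_def using closedin_subset by fastforce

lemma quasi_affine_space: "quasi_affine n {x. length x = n}"
  unfolding quasi_affine_def using closedin_topspace[of "zariski n"] ratpoly_1
  by (intro exI[of _ "{x. length x = n}"] exI[of _ "\<lambda>x. 1"]) auto

lemma quasi_affine_Int: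
  assumes "quasi_affine n S" "quasi_affine n T"
  shows "quasi_affine n (S \<inter> T)"
proof -
  obtain C p D q where *: "closedin (zariski n) C" "p \<in> ratpoly n" "S = C \<inter> {x. p x \<noteq> 0}"
     "closedin (zariski n) D" "q \<in> ratpoly n" "T = D \<inter> {x. q x \<noteq> 0}"
    using assms unfolding quasi_affine_def by blast
  then show ?thesis
    unfolding quasi_affine_def
    by (intro exI[of _ "C \<inter> D"] exI[of _ "\<lambda>x. p x * q x"]) (auto intro: ratpoly.mult)
qed

lemma quasi_affine_zero:
  assumes S: "quasi_affine n S" and p: "p \<in> ratpoly n"
  shows "quasi_affine n {x \<in> S. p x = 0}"
proof -
  have "quasi_affine n {x. length x = n \<and> p x = 0}"
    unfolding quasi_affine_def using closedin_zariski_zero[OF p] ratpoly_1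
    by (intro exI[of _ "{x. length x = n \<and> p x = 0}"] exI[of _ "\<lambda>x. 1"]) auto
  moreover have "{x \<in> S. p x = 0} = S \<inter> {x. length x = n \<and> p x = 0}"
    using quasi_affine_length[OF S] by auto
  ultimately show ?thesis using quasi_affine_Int[OF S] by simp
qed

lemma quasi_affine_nonzero:
  assumes S: "quasi_affine n S" and p: "p \<in> ratpoly n"
  shows "quasi_affine n {x \<in> S. p x \<noteq> 0}"
proof -
  have "quasi_affine n {x. length x = n \<and> p x \<noteq> 0}"
    unfolding quasi_affine_def using closedin_topspace[of "zariski n"] p
    by (intro exI[of _ "{x. length x = n}"] exI[of _ p]) auto
  moreover have "{x \<in> S. p x \<noteq> 0} = S \<inter> {x. length x = n \<and> p x \<noteq> 0}"
    using quasi_affine_length[OF S] by auto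
  ultimately show ?thesis using quasi_affine_Int[OF S] by simp
qed

lemma ratpoly_subst:
  assumes "p \<in> ratpoly (length fs)" "set fs \<subseteq> ratpoly n"
  shows "(\<lambda>x. p (map (\<lambda>f. f x) fs)) \<in> ratpoly n"
  using assms(1)
proof induction
  case (coord i)
  then have "fs ! i \<in> ratpoly n" using assms(2) by auto
  then show ?case using coord by simp
qed (auto intro: ratpoly.intros)

text \<open>Polynomial maps pull back polynomials to polynomials.  This is used for the two projections of a
  product.\<close>

lemma quasi_affine_vimage:
  assumes S: "quasi_affine (length fs) S" and fs: "set fs \<subseteq> ratpoly n"
  shows "quasi_affine n {x. length x = n \<and> map (\<lambda>f. f x) fs \<in> S}"
proof -
  let ?\<phi> = "\<lambda>x. map (\<lambda>f. f x) fs" and ?m = "length fs"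
  obtain C q where C: "closedin (zariski ?m) C" and q: "q \<in> ratpoly ?m"
    and Seq: "S = C \<inter> {x. q x \<noteq> 0}"
    using S unfolding quasi_affine_def by blast
  obtain P where P: "P \<subseteq> ratpoly ?m"
    "{x. length x = ?m} - C = {x. length x = ?m \<and> (\<exists>p\<in>P. p x \<noteq> 0)}"
    using C unfolding closedin_def openin_zariski by auto
  have Ceq: "x \<in> C \<longleftrightarrow> (\<forall>p\<in>P. p x = 0)" if "length x = ?m" for x
    using P(2) that by auto
  let ?Q = "(\<lambda>p x. p (?\<phi> x)) ` P"
  have "?Q \<subseteq> ratpoly n" using P(1) ratpoly_subst[OF _ fs] by auto
  moreover have "{x. length x = n} - {x. length x = n \<and> ?\<phi> x \<in> C}
      = {x. length x = n \<and> (\<exists>p\<in>?Q. p x \<noteq> 0)}"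
    using Ceq by auto
  ultimately have "openin (zariski n) ({x. length x = n} - {x. length x = n \<and> ?\<phi> x \<in> C})"
    unfolding openin_zariski by blast
  then have "closedin (zariski n) {x. length x = n \<and> ?\<phi> x \<in> C}"
    unfolding closedin_def by auto
  moreover have "(\<lambda>x. q (?\<phi> x)) \<in> ratpoly n" using q fs by (rule ratpoly_subst)
  moreover have "{x. length x = n \<and> ?\<phi> x \<in> S} = {x. length x = n \<and> ?\<phi> x \<in> C} \<inter> {x. q (?\<phi> x) \<noteq> 0}"
    unfolding Seq by auto
  ultimately show ?thesis unfolding quasi_affine_def by blast
qed

definition list_prod :: "'a list set \<Rightarrow> 'a list set \<Rightarrow> 'a list set" (infixr "\<otimes>" 70) where
  "S \<otimes> T = {x @ y |x y. x \<in> S \<and> y \<in> T}"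

lemma list_prod_eq:
  assumes "S \<subseteq> {x. length x = n}" "T \<subseteq> {x. length x = m}"
  shows "S \<otimes> T = {z. length z = n + m \<and> take n z \<in> S \<and> drop n z \<in> T}"
proof (intro equalityI subsetI)
  fix z assume "z \<in> {z. length z = n + m \<and> take n z \<in> S \<and> drop n z \<in> T}"
  then show "z \<in> S \<otimes> T" unfolding list_prod_def
    using append_take_drop_id[of n z, symmetric] by blast
qed (use assms[THEN subsetD] in \<open>auto simp: list_prod_def\<close>)

lemma quasi_affine_list_prod:
  assumes S: "quasi_affine n S" and T: "quasi_affine m T"
  shows "quasi_affine (n + m) (S \<otimes> T)"
proof -
  let ?fs = "map (\<lambda>i x. x ! i) [0..<n] :: (complex list \<Rightarrow> complex) list"
  let ?gs = "map (\<lambda>i x. x ! i) [n..<n + m] :: (complex list \<Rightarrow> complex) list"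
  have "quasi_affine (n + m) {z. length z = n + m \<and> map (\<lambda>f. f z) ?fs \<in> S}"
    using S by (intro quasi_affine_vimage) (auto intro: ratpoly.coord)
  moreover have "quasi_affine (n + m) {z. length z = n + m \<and> map (\<lambda>f. f z) ?gs \<in> T}"
    using T by (intro quasi_affine_vimage) (auto intro: ratpoly.coord)
  moreover have "map (\<lambda>f. f z) ?fs = take n z" "map (\<lambda>f. f z) ?gs = drop n z"
    if "length z = n + m" for z :: "complex list"
    using that by (auto intro!: nth_equalityI)
  then have "S \<otimes> T = {z. length z = n + m \<and> map (\<lambda>f. f z) ?fs \<in> S} \<inter>
      {z. length z = n + m \<and> map (\<lambda>f. f z) ?gs \<in> T}"
    unfolding list_prod_eq[OF quasi_affine_length[OF S] quasi_affine_length[OF T]] by auto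
  ultimately show ?thesis using quasi_affine_Int by simp
qed

lemma is_variety_quasi_affine_set:
  assumes "quasi_affine n S"
  shows "is_variety (induced (affine_space n) S)"
proof -
  obtain C q where "closedin (zariski n) C" "q \<in> ratpoly n" "S = C \<inter> {x. q x \<noteq> 0}"
    using assms unfolding quasi_affine_def by blast
  then show ?thesis using is_variety_quasi_affine[of n C "{q}"] by simp
qed

lemma Rep_Abs_quasi_affine:
  assumes "quasi_affine n S"
  shows "Rep_variety (Abs_variety (induced (affine_space n) S)) = induced (affine_space n) S"
  using is_variety_quasi_affine_set[OF assms] by (simp add: Abs_variety_inverse)

lemma points_quasi_affine:
  "quasi_affine n S \<Longrightarrow> points (induced (affine_space n) S) = S"
  using quasi_affine_length by auto

lemma class_of_scissors:
  assumes S: "quasi_affine n S" and p: "p \<in> ratpoly n"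
  shows "class_of n S = class_of n {x \<in> S. p x = 0} + class_of n {x \<in> S. p x \<noteq> 0}"
proof -
  let ?Z = "{x \<in> S. p x = 0}" and ?U = "{x \<in> S. p x \<noteq> 0}"
  note qa = S quasi_affine_zero[OF S p] quasi_affine_nonzero[OF S p]
  have ps: "topspace (subtopology (zariski n) S) = S" using points_quasi_affine[OF S] by simp
  have "?Z = {x. length x = n \<and> p x = 0} \<inter> S" using quasi_affine_length[OF S] by auto
  then have "closedin (subtopology (zariski n) S) ?Z"
    using closedin_zariski_zero[OF p] by (auto simp: closedin_subtopology)
  moreover have "S - ?Z = ?U" by auto
  moreover have "induced (induced (affine_space n) S) W = induced (affine_space n) W" if "W \<subseteq> S" for W
    using that by (intro induced_induced function_sheaf_affine_space)
  ultimately have "symbol (Abs_variety (induced (affine_space n) S)) -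
      (symbol (Abs_variety (induced (affine_space n) ?Z)) +
       symbol (Abs_variety (induced (affine_space n) ?U))) \<in> K0_ideal"
    by (intro K0_ideal.scissors[of _ ?Z])
      (simp_all add: qa[THEN Rep_Abs_quasi_affine] ps del: topspace_subtopology)
  then show ?thesis
    unfolding class_of_def by transfer (simp add: K0_rel_def)
qed

lemma class_of_isomorphic:
  assumes S: "quasi_affine n S" and T: "quasi_affine m T"
    and "isomorphic (induced (affine_space n) S) (induced (affine_space m) T)"
  shows "class_of n S = class_of m T"
proof -
  have "symbol (Abs_variety (induced (affine_space n) S)) -
      symbol (Abs_variety (induced (affine_space m) T)) \<in> K0_ideal"
    using assms(3) by (intro K0_ideal.iso) (simp add: Rep_Abs_quasi_affine S T)
  then show ?thesis
    unfolding class_of_def by transfer (simp add: K0_rel_def)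
qed

text \<open>The form in which isomorphisms are used below: the two maps are given by the lists \<open>fs\<close> and \<open>gs\<close> of
  their coordinate functions, so that only finitely many functions have to be shown regular.\<close>

lemma class_of_coordinates:
  assumes S: "quasi_affine n S" and T: "quasi_affine m T"
    and fs: "list_all (\<lambda>f. f \<in> regular (induced (affine_space n) S) S) fs" "length fs = m"
    and gs: "list_all (\<lambda>g. g \<in> regular (induced (affine_space m) T) T) gs" "length gs = n"
    and fg: "\<And>x. x \<in> S \<Longrightarrow> map (\<lambda>f. f x) fs \<in> T \<and> map (\<lambda>g. g (map (\<lambda>f. f x) fs)) gs = x"
    and gf: "\<And>y. y \<in> T \<Longrightarrow> map (\<lambda>g. g y) gs \<in> S \<and> map (\<lambda>f. f (map (\<lambda>g. g y) gs)) fs = y"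
  shows "class_of n S = class_of m T"
proof (rule class_of_isomorphic[OF S T])
  have "morphism (induced (affine_space n) S) (induced (affine_space m) T) (\<lambda>x. map (\<lambda>f. f x) fs)"
    by (rule morphism_quasi_affine[OF quasi_affine_length[OF S] quasi_affine_length[OF T]])
      (use fg fs in \<open>auto simp: list_all_length\<close>)
  moreover have "morphism (induced (affine_space m) T) (induced (affine_space n) S) (\<lambda>y. map (\<lambda>g. g y) gs)"
    by (rule morphism_quasi_affine[OF quasi_affine_length[OF T] quasi_affine_length[OF S]])
      (use gf gs in \<open>auto simp: list_all_length\<close>)
  ultimately show "isomorphic (induced (affine_space n) S) (induced (affine_space m) T)"
    unfolding isomorphic_def points_quasi_affine[OF S] points_quasi_affine[OF T]
    using fg gf by blast
qed

text \<open>The projections are \<open>take\<close> and \<open>drop\<close>; the pairing of two morphisms is the concatenation of their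
  values, whose coordinates are those of the two morphisms.\<close>

lemma is_product_list_prod:
  assumes S: "quasi_affine n S" and T: "quasi_affine m T"
  shows "is_product (Abs_variety (induced (affine_space (n + m)) (S \<otimes> T)))
     (Abs_variety (induced (affine_space n) S)) (Abs_variety (induced (affine_space m) T))
     (take n) (drop n)"
proof -
  have P: "quasi_affine (n + m) (S \<otimes> T)" using S T by (rule quasi_affine_list_prod)
  note Peq = list_prod_eq[OF quasi_affine_length[OF S] quasi_affine_length[OF T]]
  note l = S[THEN quasi_affine_length] T[THEN quasi_affine_length] P[THEN quasi_affine_length]
  let ?P = "induced (affine_space (n + m)) (S \<otimes> T)"
  let ?S = "induced (affine_space n) S" and ?T = "induced (affine_space m) T"
  have sh: "function_sheaf ?P" by (intro function_sheaf_induced function_sheaf_affine_space)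
  have oP: "openin (top_of ?P) (S \<otimes> T)" using l(3) by (simp add: openin_subtopology_refl)
  have 1: "morphism ?P ?S (take n)"
  proof (rule morphism_quasi_affine[OF l(3) l(1)])
    show "take n x \<in> S" if "x \<in> S \<otimes> T" for x using that unfolding Peq by simp
    show "(\<lambda>x. take n x ! i) \<in> regular ?P (S \<otimes> T)" if "i < n" for i
      using l(3) that by (intro regular_ratpoly) (auto intro: ratpoly.coord)
  qed
  have 2: "morphism ?P ?T (drop n)"
  proof (rule morphism_quasi_affine[OF l(3) l(2)])
    show "drop n x \<in> T" if "x \<in> S \<otimes> T" for x using that unfolding Peq by simp
    show "(\<lambda>x. drop n x ! i) \<in> regular ?P (S \<otimes> T)" if "i < m" for i
    proof (rule function_sheafD(1)[OF sh oP])
      show "(\<lambda>x. x ! (n + i)) \<in> regular ?P (S \<otimes> T)"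
        using l(3) that by (intro regular_ratpoly ratpoly.coord) auto
    qed (use l(3) in auto)
  qed
  have 3: "\<exists>\<gamma>. morphism (Rep_variety Q) ?P \<gamma> \<and>
             (\<forall>t\<in>points (Rep_variety Q). take n (\<gamma> t) = \<alpha> t \<and> drop n (\<gamma> t) = \<beta> t) \<and>
             (\<forall>\<delta>. morphism (Rep_variety Q) ?P \<delta> \<and>
                  (\<forall>t\<in>points (Rep_variety Q). take n (\<delta> t) = \<alpha> t \<and> drop n (\<delta> t) = \<beta> t) \<longrightarrow>
                  (\<forall>t\<in>points (Rep_variety Q). \<delta> t = \<gamma> t))"
    if \<alpha>: "morphism (Rep_variety Q) ?S \<alpha>" and \<beta>: "morphism (Rep_variety Q) ?T \<beta>" for Q \<alpha> \<beta>
  proof (intro exI[of _ "\<lambda>t. \<alpha> t @ \<beta> t"] conjI ballI allI impI)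
    let ?Q = "Rep_variety Q"
    have Q: "is_variety ?Q" using Rep_variety[of Q] by simp
    then have shQ: "function_sheaf ?Q" by (simp add: is_variety_def)
    have im: "\<alpha> t \<in> S" "\<beta> t \<in> T" if "t \<in> points ?Q" for t
      using morphism_in[OF \<alpha> that] morphism_in[OF \<beta> that] by auto
    have len: "length (\<alpha> t) = n" "length (\<beta> t) = m" if "t \<in> points ?Q" for t
      using im[OF that] l by auto
    show "morphism ?Q ?P (\<lambda>t. \<alpha> t @ \<beta> t)"
    proof (rule morphism_to_quasi_affine[OF Q l(3)])
      show "\<alpha> t @ \<beta> t \<in> S \<otimes> T" if "t \<in> points ?Q" for t
        using im[OF that] by (auto simp: list_prod_def)
      fix i assume i: "i < n + m"
      show "(\<lambda>t. (\<alpha> t @ \<beta> t) ! i) \<in> regular ?Q (points ?Q)"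
      proof (cases "i < n")
        case True
        show ?thesis
          by (rule function_sheafD(1)[OF shQ openin_topspace regular_coord_of_morphism[OF \<alpha> l(1) True]])
            (use len True in \<open>auto simp: nth_append\<close>)
      next
        case False
        then have "i - n < m" using i by simp
        then show ?thesis
          by (rule function_sheafD(1)[OF shQ openin_topspace regular_coord_of_morphism[OF \<beta> l(2)]])
            (use len False in \<open>auto simp: nth_append\<close>)
      qed
    qed
    fix t assume t: "t \<in> points ?Q"
    show "take n (\<alpha> t @ \<beta> t) = \<alpha> t" "drop n (\<alpha> t @ \<beta> t) = \<beta> t"
      using len[OF t] by auto
    fix \<delta> assume "morphism ?Q ?P \<delta> \<and>
      (\<forall>t\<in>points ?Q. take n (\<delta> t) = \<alpha> t \<and> drop n (\<delta> t) = \<beta> t)"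
    then show "\<delta> t = \<alpha> t @ \<beta> t"
      using t append_take_drop_id[of n "\<delta> t"] by metis
  qed
  show ?thesis
    unfolding is_product_def Rep_Abs_quasi_affine[OF S] Rep_Abs_quasi_affine[OF T] Rep_Abs_quasi_affine[OF P]
    using 1 2 3 by blast
qed

lemma class_of_list_prod:
  assumes S: "quasi_affine n S" and T: "quasi_affine m T"
  shows "class_of (n + m) (S \<otimes> T) = class_of n S * class_of m T"
  using K0_ideal.product[OF is_product_list_prod[OF S T]]
  unfolding class_of_def by transfer (simp add: K0_rel_def)

lemma class_of_point: "class_of 0 {[]} = 1"
proof -
  have "induced (affine_space 0) {[]} = affine_space 0"
    using induced_affine_space_UNIV[of 0] by simp
  then have "Rep_variety (Abs_variety (induced (affine_space 0) {[]})) = affine_space 0"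
    using is_variety_affine_space[of 0] by (simp add: Abs_variety_inverse)
  then have "symbol (Abs_variety (induced (affine_space 0) {[]})) - 1 \<in> K0_ideal"
    by (rule K0_ideal.point)
  then show ?thesis unfolding class_of_def by transfer (simp add: K0_rel_def)
qed

lemma class_of_line: "class_of 1 {x. length x = 1} = \<bbbL>"
  unfolding class_of_def lefschetz_def induced_affine_space_UNIV ..

section \<open>Tori and affine spaces as factors\<close>

abbreviation line :: "complex list set" where
  "line \<equiv> {x. length x = 1}"

abbreviation Gm :: "complex list set" where
  "Gm \<equiv> {x \<in> line. x ! 0 \<noteq> 0}"

lemma quasi_affine_Gm: "quasi_affine 1 Gm"
  by (intro quasi_affine_nonzero quasi_affine_space ratpoly.coord) simp

lemma quasi_affine_point: "quasi_affine 0 {[]}"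
  using quasi_affine_space[of 0] by simp

lemma regular_coord:
  "quasi_affine n S \<Longrightarrow> i < n \<Longrightarrow> (\<lambda>x. x ! i) \<in> regular (induced (affine_space n) S) S"
  using quasi_affine_length by (intro regular_ratpoly ratpoly.coord) auto

lemma regular_const:
  "quasi_affine n S \<Longrightarrow> (\<lambda>x. of_rat c) \<in> regular (induced (affine_space n) S) S"
  using quasi_affine_length by (intro regular_ratpoly ratpoly.const) auto

lemma regular_0: "quasi_affine n S \<Longrightarrow> (\<lambda>x. 0) \<in> regular (induced (affine_space n) S) S"
  using regular_const[of n S 0] by simp

lemma regular_1: "quasi_affine n S \<Longrightarrow> (\<lambda>x. 1) \<in> regular (induced (affine_space n) S) S"
  using regular_const[of n S 1] by simp

lemma regular_minus_1: "quasi_affine n S \<Longrightarrow> (\<lambda>x. - 1) \<in> regular (induced (affine_space n) S) S"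
  using regular_const[of n S "- 1"] by simp

lemma regular_diff:
  assumes S: "quasi_affine n S"
    and "f \<in> regular (induced (affine_space n) S) S" "g \<in> regular (induced (affine_space n) S) S"
  shows "(\<lambda>x. f x - g x) \<in> regular (induced (affine_space n) S) S"
  using regular_add[OF assms(2) regular_mult[OF regular_minus_1[OF S] assms(3)]] by simp

lemmas regular_intros =
  regular_add regular_mult regular_diff regular_divide regular_coord regular_0 regular_1 regular_minus_1

lemma class_of_Gm: "class_of 1 Gm = \<bbbL> - 1"
proof -
  have 0: "quasi_affine 1 {x \<in> line. x ! 0 = 0}"
    by (intro quasi_affine_zero quasi_affine_space ratpoly.coord) simp
  have "\<bbbL> = class_of 1 {x \<in> line. x ! 0 = 0} + class_of 1 Gm"
    unfolding class_of_line[symmetric]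
    by (intro class_of_scissors quasi_affine_space ratpoly.coord) simp
  moreover have "class_of 1 {x \<in> line. x ! 0 = 0} = class_of 0 {[]}"
    by (rule class_of_coordinates[where fs = "[]" and gs = "[\<lambda>x. 0]", OF 0 quasi_affine_point])
      (auto simp: length_Suc_conv regular_0[OF quasi_affine_point])
  ultimately show ?thesis unfolding class_of_point by (metis add_diff_cancel_left')
qed

text \<open>The first \<open>a\<close> coordinates are nonzero, the next \<open>b\<close> are arbitrary, and the remaining ones form a
  point of \<open>S\<close>.  Every stratum below is isomorphic to a set of this form.\<close>

definition torus_affine :: "nat \<Rightarrow> nat \<Rightarrow> complex list set \<Rightarrow> complex list set" where
  "torus_affine a b S = ((\<otimes>) Gm ^^ a) (((\<otimes>) line ^^ b) S)"

lemma quasi_affine_class_of_iterate: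
  assumes F: "quasi_affine 1 F" and S: "quasi_affine n S"
  shows "quasi_affine (k + n) (((\<otimes>) F ^^ k) S) \<and>
    class_of (k + n) (((\<otimes>) F ^^ k) S) = class_of 1 F ^ k * class_of n S"
proof (induction k)
  case (Suc k)
  then show ?case
    using quasi_affine_list_prod[OF F, of "k + n"] class_of_list_prod[OF F, of "k + n"]
    by (simp add: mult.assoc)
qed (simp add: S)

lemma
  assumes S: "quasi_affine n S"
  shows quasi_affine_torus_affine: "quasi_affine (a + (b + n)) (torus_affine a b S)"
    and class_of_torus_affine:
      "class_of (a + (b + n)) (torus_affine a b S) = (\<bbbL> - 1) ^ a * (\<bbbL> ^ b * class_of n S)"
proof -
  note b = quasi_affine_class_of_iterate[OF quasi_affine_space S, of b]
  note a = quasi_affine_class_of_iterate[OF quasi_affine_Gm b[THEN conjunct1], of a]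
  show "quasi_affine (a + (b + n)) (torus_affine a b S)"
    unfolding torus_affine_def using a by blast
  show "class_of (a + (b + n)) (torus_affine a b S) = (\<bbbL> - 1) ^ a * (\<bbbL> ^ b * class_of n S)"
    unfolding torus_affine_def using a b by (simp only: class_of_Gm class_of_line)
qed

lemma Nil_in_torus_affine: "[] \<in> torus_affine a b S \<longleftrightarrow> a = 0 \<and> b = 0 \<and> [] \<in> S"
  unfolding torus_affine_def by (cases a; cases b) (auto simp: list_prod_def)

lemma Cons_in_list_prod:
  assumes "F \<subseteq> line"
  shows "c # x \<in> F \<otimes> S \<longleftrightarrow> [c] \<in> F \<and> x \<in> S"
proof
  assume "c # x \<in> F \<otimes> S"
  then obtain u v where *: "c # x = u @ v" "u \<in> F" "v \<in> S" unfolding list_prod_def by blast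
  moreover obtain d where "u = [d]" using assms * by (auto simp: length_Suc_conv)
  ultimately show "[c] \<in> F \<and> x \<in> S" by simp
next
  assume "[c] \<in> F \<and> x \<in> S"
  moreover have "c # x = [c] @ x" by simp
  ultimately show "c # x \<in> F \<otimes> S" unfolding list_prod_def by blast
qed

lemma Cons_in_torus_affine:
  "c # x \<in> torus_affine (Suc a) b S \<longleftrightarrow> c \<noteq> 0 \<and> x \<in> torus_affine a b S"
  "c # x \<in> torus_affine 0 (Suc b) S \<longleftrightarrow> x \<in> torus_affine 0 b S"
  "x \<in> torus_affine 0 0 S \<longleftrightarrow> x \<in> S"
proof -
  have Gm: "c # x \<in> Gm \<otimes> T \<longleftrightarrow> c \<noteq> 0 \<and> x \<in> T" for T
    by (subst Cons_in_list_prod) auto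
  have line: "c # x \<in> line \<otimes> T \<longleftrightarrow> x \<in> T" for T :: "complex list set"
    by (subst Cons_in_list_prod) auto
  show "c # x \<in> torus_affine (Suc a) b S \<longleftrightarrow> c \<noteq> 0 \<and> x \<in> torus_affine a b S"
    unfolding torus_affine_def funpow.simps o_def Gm ..
  show "c # x \<in> torus_affine 0 (Suc b) S \<longleftrightarrow> x \<in> torus_affine 0 b S"
    unfolding torus_affine_def funpow.simps o_def id_def line ..
qed (simp add: torus_affine_def)

section \<open>Invertible matrices\<close>

definition GL2 :: "complex list set" where
  "GL2 = {x \<in> {x. length x = 4}. x ! 0 * x ! 3 - x ! 1 * x ! 2 \<noteq> 0}"

text \<open>Matrices are lists of their entries, row by row.\<close>

definition det3 :: "complex list \<Rightarrow> complex" where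
  "det3 x = x ! 0 * (x ! 4 * x ! 8 - x ! 5 * x ! 7) - x ! 1 * (x ! 3 * x ! 8 - x ! 5 * x ! 6)
     + x ! 2 * (x ! 3 * x ! 7 - x ! 4 * x ! 6)"

definition GL3 :: "complex list set" where
  "GL3 = {x \<in> {x. length x = 9}. det3 x \<noteq> 0}"

lemmas ratpoly_intros = ratpoly_diff ratpoly_0 ratpoly_1 ratpoly.add ratpoly.mult ratpoly.coord

lemma quasi_affine_GL2: "quasi_affine 4 GL2"
  unfolding GL2_def by (intro quasi_affine_nonzero quasi_affine_space ratpoly_intros) simp_all

lemma quasi_affine_GL3: "quasi_affine 9 GL3"
  unfolding GL3_def det3_def
  by (intro quasi_affine_nonzero quasi_affine_space ratpoly_intros) simp_all

lemma GL2_iff: "x \<in> GL2 \<longleftrightarrow> (\<exists>a b c d. x = [a, b, c, d] \<and> a * d - b * c \<noteq> 0)"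
  unfolding GL2_def by (auto simp: length_Suc_conv numeral_eq_Suc)

lemma in_torus_affine_iff:
  "x \<in> torus_affine (Suc a) b S \<longleftrightarrow> (\<exists>c y. x = c # y \<and> c \<noteq> 0 \<and> y \<in> torus_affine a b S)"
  "x \<in> torus_affine 0 (Suc b) S \<longleftrightarrow> (\<exists>c y. x = c # y \<and> y \<in> torus_affine 0 b S)"
  "x \<in> torus_affine 0 0 S \<longleftrightarrow> x \<in> S"
  by (cases x; simp add: Nil_in_torus_affine Cons_in_torus_affine)+

lemmas torus_affine_iff = in_torus_affine_iff numeral_2_eq_2 numeral_3_eq_3 numeral_eq_Suc

text \<open>If the upper left entry vanishes, the two off-diagonal entries are nonzero and the last one is free.
  Otherwise the determinant may replace the last entry as a coordinate, which makes it a free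
  parameter of the torus.\<close>

lemma class_of_GL2: "class_of 4 GL2 = (\<bbbL> - 1) ^ 2 * \<bbbL> + (\<bbbL> - 1) ^ 2 * \<bbbL> ^ 2"
proof -
  let ?Z = "{x \<in> GL2. x ! 0 = 0}" and ?U = "{x \<in> GL2. x ! 0 \<noteq> 0}"
  have c0: "(\<lambda>x. x ! 0) \<in> ratpoly 4" by (intro ratpoly.coord) simp
  have Z: "quasi_affine 4 ?Z" using quasi_affine_GL2 c0 by (rule quasi_affine_zero)
  have U: "quasi_affine 4 ?U" using quasi_affine_GL2 c0 by (rule quasi_affine_nonzero)
  have TZ: "quasi_affine 3 (torus_affine 2 1 {[]})" and TU: "quasi_affine 4 (torus_affine 2 2 {[]})"
    using quasi_affine_torus_affine[OF quasi_affine_point, of 2 1]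
      quasi_affine_torus_affine[OF quasi_affine_point, of 2 2] by simp_all
  have TUi: "x \<in> torus_affine 2 2 {[]} \<longleftrightarrow> (\<exists>a b c d. x = [a, b, c, d] \<and> a \<noteq> 0 \<and> b \<noteq> 0)" for x
    by (auto simp: torus_affine_iff)
  have TZi: "x \<in> torus_affine 2 1 {[]} \<longleftrightarrow> (\<exists>a b c. x = [a, b, c] \<and> a \<noteq> 0 \<and> b \<noteq> 0)" for x
    by (auto simp: torus_affine_iff)
  have "class_of 4 ?Z = class_of 3 (torus_affine 2 1 {[]})"
  proof (rule class_of_coordinates[OF Z TZ,
          where fs = "[\<lambda>x. x ! 1, \<lambda>x. x ! 2, \<lambda>x. x ! 3]"
            and gs = "[\<lambda>y. 0, \<lambda>y. y ! 0, \<lambda>y. y ! 1, \<lambda>y. y ! 2]"], goal_cases)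
    case 1 show ?case unfolding list.pred_inject by (intro conjI TrueI regular_intros Z) simp_all
  next
    case 3 show ?case unfolding list.pred_inject by (intro conjI TrueI regular_intros TZ) simp_all
  next
    case 5 then show ?case unfolding GL2_iff TZi by auto
  next
    case 6 then show ?case unfolding GL2_iff TZi by auto
  qed simp_all
  moreover have "class_of 4 ?U = class_of 4 (torus_affine 2 2 {[]})"
  proof (rule class_of_coordinates[OF U TU,
          where fs = "[\<lambda>x. x ! 0, \<lambda>x. x ! 0 * x ! 3 - x ! 1 * x ! 2, \<lambda>x. x ! 1, \<lambda>x. x ! 2]"
            and gs = "[\<lambda>y. y ! 0, \<lambda>y. y ! 2, \<lambda>y. y ! 3, \<lambda>y. (y ! 1 + y ! 2 * y ! 3) / y ! 0]"], goal_cases)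
    case 1 show ?case unfolding list.pred_inject by (intro conjI TrueI regular_intros U) simp_all
  next
    case 3 show ?case unfolding list.pred_inject by (intro conjI TrueI regular_intros TU) (auto simp: TUi)
  next
    case 5 then show ?case unfolding GL2_iff TUi by auto
  next
    case 6 then show ?case unfolding GL2_iff TUi by auto
  qed simp_all
  ultimately show ?thesis
    using class_of_scissors[OF quasi_affine_GL2 c0] class_of_torus_affine[OF quasi_affine_point, of 2 1]
      class_of_torus_affine[OF quasi_affine_point, of 2 2] by (simp add: class_of_point)
qed


lemma GL3_iff: "x \<in> GL3 \<longleftrightarrow> (\<exists>a b c d e f g h i. x = [a, b, c, d, e, f, g, h, i] \<and>
    a * (e * i - f * h) - b * (d * i - f * g) + c * (d * h - e * g) \<noteq> 0)"
  unfolding GL3_def det3_def by (auto simp: length_Suc_conv numeral_eq_Suc)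

text \<open>Strata by the first nonzero entry of the first column, which is the pivot.  Subtracting multiples of
  the pivot row clears the column and leaves a matrix in \<open>GL2\<close>; the pivot, the rest of its row and
  the column entries below the pivot are free parameters.\<close>

lemma class_of_GL3: "class_of 9 GL3 = (\<bbbL> - 1) * \<bbbL> ^ 2 * class_of 4 GL2
   + (\<bbbL> - 1) * \<bbbL> ^ 3 * class_of 4 GL2 + (\<bbbL> - 1) * \<bbbL> ^ 4 * class_of 4 GL2"
proof -
  let ?U1 = "{x \<in> GL3. x ! 0 \<noteq> 0}" and ?Z = "{x \<in> GL3. x ! 0 = 0}"
  let ?U2 = "{x \<in> ?Z. x ! 3 \<noteq> 0}" and ?U3 = "{x \<in> ?Z. x ! 3 = 0}"
  have c: "(\<lambda>x. x ! 0) \<in> ratpoly 9" "(\<lambda>x. x ! 3) \<in> ratpoly 9" by (intro ratpoly.coord; simp)+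
  have U1: "quasi_affine 9 ?U1" using quasi_affine_GL3 c(1) by (rule quasi_affine_nonzero)
  have Z: "quasi_affine 9 ?Z" using quasi_affine_GL3 c(1) by (rule quasi_affine_zero)
  have U2: "quasi_affine 9 ?U2" using Z c(2) by (rule quasi_affine_nonzero)
  have U3: "quasi_affine 9 ?U3" using Z c(2) by (rule quasi_affine_zero)
  have T1: "quasi_affine 9 (torus_affine 1 4 GL2)" and T2: "quasi_affine 8 (torus_affine 1 3 GL2)"
    and T3: "quasi_affine 7 (torus_affine 1 2 GL2)"
    using quasi_affine_torus_affine[OF quasi_affine_GL2, of 1 4]
      quasi_affine_torus_affine[OF quasi_affine_GL2, of 1 3]
      quasi_affine_torus_affine[OF quasi_affine_GL2, of 1 2] by simp_all
  have T1_iff: "x \<in> torus_affine 1 4 GL2 \<longleftrightarrow> (\<exists>u p q r s a b c d. x = [u, p, q, r, s, a, b, c, d] \<and>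
      u \<noteq> 0 \<and> a * d - b * c \<noteq> 0)" for x
    by (auto simp: torus_affine_iff GL2_iff)
  have T2_iff: "x \<in> torus_affine 1 3 GL2 \<longleftrightarrow> (\<exists>u p q r a b c d. x = [u, p, q, r, a, b, c, d] \<and>
      u \<noteq> 0 \<and> a * d - b * c \<noteq> 0)" for x
    by (auto simp: torus_affine_iff GL2_iff)
  have T3_iff: "x \<in> torus_affine 1 2 GL2 \<longleftrightarrow> (\<exists>u p q a b c d. x = [u, p, q, a, b, c, d] \<and>
      u \<noteq> 0 \<and> a * d - b * c \<noteq> 0)" for x
    by (auto simp: torus_affine_iff GL2_iff)
  \<comment> \<open>The last four coordinates are the Schur complement of the pivot \<open>x ! 0\<close>.\<close>
  have "class_of 9 ?U1 = class_of 9 (torus_affine 1 4 GL2)"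
  proof (rule class_of_coordinates[OF U1 T1,
          where fs = "[\<lambda>x. x ! 0, \<lambda>x. x ! 1, \<lambda>x. x ! 2, \<lambda>x. x ! 3, \<lambda>x. x ! 6,
                \<lambda>x. x ! 4 - x ! 3 * x ! 1 / x ! 0, \<lambda>x. x ! 5 - x ! 3 * x ! 2 / x ! 0,
                \<lambda>x. x ! 7 - x ! 6 * x ! 1 / x ! 0, \<lambda>x. x ! 8 - x ! 6 * x ! 2 / x ! 0]"
            and gs = "[\<lambda>y. y ! 0, \<lambda>y. y ! 1, \<lambda>y. y ! 2,
                \<lambda>y. y ! 3, \<lambda>y. y ! 5 + y ! 3 * y ! 1 / y ! 0, \<lambda>y. y ! 6 + y ! 3 * y ! 2 / y ! 0,
                \<lambda>y. y ! 4, \<lambda>y. y ! 7 + y ! 4 * y ! 1 / y ! 0, \<lambda>y. y ! 8 + y ! 4 * y ! 2 / y ! 0]"],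
        goal_cases)
    case 1 show ?case unfolding list.pred_inject by (intro conjI TrueI regular_intros U1) simp_all
  next
    case 3 show ?case unfolding list.pred_inject by (intro conjI TrueI regular_intros T1) (auto simp: T1_iff simp del: One_nat_def)
  next
    case (5 x)
    then obtain a b c d e f g h i where x: "x = [a, b, c, d, e, f, g, h, i]" and a: "a \<noteq> 0"
      and det: "a * (e * i - f * h) - b * (d * i - f * g) + c * (d * h - e * g) \<noteq> 0"
      unfolding GL3_iff by auto
    have eq: "(e - d * b / a) * (i - g * c / a) - (f - d * c / a) * (h - g * b / a)
        = (a * (e * i - f * h) - b * (d * i - f * g) + c * (d * h - e * g)) / a"
      using a by (simp add: field_simps)
    show ?case unfolding x T1_iff using det a by (simp add: eq del: right_minus_eq)
  next
    case (6 y)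
    then obtain u p q r s a b c d where y: "y = [u, p, q, r, s, a, b, c, d]"
      and nz: "u \<noteq> 0" "a * d - b * c \<noteq> 0"
      unfolding T1_iff by blast
    have eq: "u * ((a + r * p / u) * (d + s * q / u) - (b + r * q / u) * (c + s * p / u))
        - p * (r * (d + s * q / u) - (b + r * q / u) * s) + q * (r * (c + s * p / u) - (a + r * p / u) * s)
        = u * (a * d - b * c)"
      using nz(1) by (simp add: field_simps)
    show ?case unfolding y GL3_iff using nz by (simp add: eq del: right_minus_eq)
  qed simp_all
  \<comment> \<open>The pivot is \<open>x ! 3\<close>; the first row is not changed by the elimination.\<close>
  moreover have "class_of 9 ?U2 = class_of 8 (torus_affine 1 3 GL2)"
  proof (rule class_of_coordinates[OF U2 T2,
          where fs = "[\<lambda>x. x ! 3, \<lambda>x. x ! 4, \<lambda>x. x ! 5, \<lambda>x. x ! 6, \<lambda>x. x ! 1, \<lambda>x. x ! 2,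
                \<lambda>x. x ! 7 - x ! 6 * x ! 4 / x ! 3, \<lambda>x. x ! 8 - x ! 6 * x ! 5 / x ! 3]"
            and gs = "[\<lambda>y. 0, \<lambda>y. y ! 4, \<lambda>y. y ! 5, \<lambda>y. y ! 0, \<lambda>y. y ! 1, \<lambda>y. y ! 2,
                \<lambda>y. y ! 3, \<lambda>y. y ! 6 + y ! 3 * y ! 1 / y ! 0, \<lambda>y. y ! 7 + y ! 3 * y ! 2 / y ! 0]"],
        goal_cases)
    case 1 show ?case unfolding list.pred_inject by (intro conjI TrueI regular_intros U2) simp_all
  next
    case 3 show ?case unfolding list.pred_inject by (intro conjI TrueI regular_intros T2) (auto simp: T2_iff simp del: One_nat_def)
  next
    case (5 x)
    then obtain b c d e f g h i where x: "x = [0, b, c, d, e, f, g, h, i]" and d: "d \<noteq> 0"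
      and det: "- (b * (d * i - f * g)) + c * (d * h - e * g) \<noteq> 0"
      unfolding GL3_iff by auto
    have eq: "b * (i - g * f / d) - c * (h - g * e / d)
        = - (- (b * (d * i - f * g)) + c * (d * h - e * g)) / d"
      using d by (simp add: field_simps)
    have "b * (i - g * f / d) - c * (h - g * e / d) \<noteq> 0" unfolding eq using det d by simp
    then show ?case unfolding x T2_iff using d by simp
  next
    case (6 y)
    then obtain u p q r a b c d where y: "y = [u, p, q, r, a, b, c, d]"
      and nz: "u \<noteq> 0" "a * d - b * c \<noteq> 0"
      unfolding T2_iff by blast
    have eq: "b * (u * (c + r * p / u) - p * r) - a * (u * (d + r * q / u) - q * r)
        = - (u * (a * d - b * c))"
      using nz(1) by (simp add: field_simps)
    have "b * (u * (c + r * p / u) - p * r) - a * (u * (d + r * q / u) - q * r) \<noteq> 0"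
      unfolding eq using nz by simp
    then show ?case unfolding y GL3_iff using nz by simp
  qed simp_all
  \<comment> \<open>The pivot \<open>x ! 6\<close> is nonzero because the matrix is invertible.\<close>
  moreover have "class_of 9 ?U3 = class_of 7 (torus_affine 1 2 GL2)"
  proof (rule class_of_coordinates[OF U3 T3,
          where fs = "[\<lambda>x. x ! 6, \<lambda>x. x ! 7, \<lambda>x. x ! 8, \<lambda>x. x ! 1, \<lambda>x. x ! 2, \<lambda>x. x ! 4, \<lambda>x. x ! 5]"
            and gs = "[\<lambda>y. 0, \<lambda>y. y ! 3, \<lambda>y. y ! 4, \<lambda>y. 0, \<lambda>y. y ! 5, \<lambda>y. y ! 6,
                \<lambda>y. y ! 0, \<lambda>y. y ! 1, \<lambda>y. y ! 2]"],
        goal_cases)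
    case 1 show ?case unfolding list.pred_inject by (intro conjI TrueI regular_intros U3) simp_all
  next
    case 3 show ?case unfolding list.pred_inject by (intro conjI TrueI regular_intros T3) simp_all
  next
    case 5 then show ?case unfolding GL3_iff T3_iff by (auto simp: algebra_simps)
  next
    case 6 then show ?case unfolding GL3_iff T3_iff by (auto simp: algebra_simps)
  qed simp_all
  ultimately show ?thesis
    using class_of_scissors[OF quasi_affine_GL3 c(1)] class_of_scissors[OF Z c(2)]
      class_of_torus_affine[OF quasi_affine_GL2, of 1 4]
      class_of_torus_affine[OF quasi_affine_GL2, of 1 3]
      class_of_torus_affine[OF quasi_affine_GL2, of 1 2] by (simp add: mult.assoc)
qed

section \<open>The complement of the divisor in the group of invertible matrices\<close>

text \<open>What remains of a matrix outside the divisor after its first row and column have been scaled to ones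
  and the first row subtracted from the others.  The entry \<open>x ! 1\<close> is then one less than the
  scaled entry at position \<open>(2,3)\<close>, which is required to be nonzero.\<close>

definition V :: "complex list set" where
  "V = {x \<in> GL2. x ! 1 + 1 \<noteq> 0}"

lemma V_iff: "x \<in> V \<longleftrightarrow> (\<exists>a b c d. x = [a, b, c, d] \<and> a * d - b * c \<noteq> 0 \<and> b + 1 \<noteq> 0)"
  unfolding V_def by (auto simp: GL2_iff)

lemma ratpoly_V: "(\<lambda>x. x ! 1 + 1) \<in> ratpoly 4"
  by (intro ratpoly_intros) simp

lemma quasi_affine_V: "quasi_affine 4 V"
  unfolding V_def using quasi_affine_GL2 ratpoly_V by (rule quasi_affine_nonzero)

lemma class_of_V: "class_of 4 V = class_of 4 GL2 - (\<bbbL> - 1) * \<bbbL> ^ 2"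
proof -
  let ?Z = "{x \<in> GL2. x ! 1 + 1 = 0}"
  have Z: "quasi_affine 4 ?Z" using quasi_affine_GL2 ratpoly_V by (rule quasi_affine_zero)
  have T: "quasi_affine 3 (torus_affine 1 2 {[]})"
    using quasi_affine_torus_affine[OF quasi_affine_point, of 1 2] by (simp add: numeral_3_eq_3)
  have T_iff: "x \<in> torus_affine 1 2 {[]} \<longleftrightarrow> (\<exists>u a d. x = [u, a, d] \<and> u \<noteq> 0)" for x
    by (auto simp: torus_affine_iff)
  have Z_iff: "x \<in> ?Z \<longleftrightarrow> (\<exists>a c d. x = [a, - 1, c, d] \<and> a * d + c \<noteq> 0)" for x
    by (auto simp: GL2_iff add_eq_0_iff2)
  have "class_of 4 ?Z = class_of 3 (torus_affine 1 2 {[]})"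
  \<comment> \<open>For upper right entry \<open>-1\<close> the determinant is linear in \<open>x ! 2\<close> with coefficient one, hence
    can replace it as a coordinate.\<close>
  proof (rule class_of_coordinates[OF Z T,
          where fs = "[\<lambda>x. x ! 0 * x ! 3 + x ! 2, \<lambda>x. x ! 0, \<lambda>x. x ! 3]"
            and gs = "[\<lambda>y. y ! 1, \<lambda>y. - 1, \<lambda>y. y ! 0 - y ! 1 * y ! 2, \<lambda>y. y ! 2]"], goal_cases)
    case 1 show ?case unfolding list.pred_inject by (intro conjI TrueI regular_intros Z) simp_all
  next
    case 3 show ?case unfolding list.pred_inject by (intro conjI TrueI regular_intros T) simp_all
  next
    case 5 then show ?case unfolding Z_iff T_iff by auto
  next
    case 6 then show ?case unfolding Z_iff T_iff by auto
  qed simp_all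
  then have "class_of 4 GL2 = (\<bbbL> - 1) * \<bbbL> ^ 2 + class_of 4 V"
    using class_of_scissors[OF quasi_affine_GL2 ratpoly_V]
      class_of_torus_affine[OF quasi_affine_point, of 1 2]
    unfolding V_def by (simp add: class_of_point numeral_3_eq_3)
  then show ?thesis by (metis add_diff_cancel_left')
qed

text \<open>The equation of the divisor in the coordinates in which the first column is the vector of row sums.\<close>

definition divisor :: "complex list \<Rightarrow> complex" where
  "divisor y = y ! 0 * y ! 1 * y ! 2 * y ! 3 * y ! 5 * y ! 6"

lemma ratpoly_divisor: "divisor \<in> ratpoly 9"
proof -
  have "(\<lambda>y. divisor y) \<in> ratpoly 9"
    unfolding divisor_def by (intro ratpoly_intros) simp_all
  then show ?thesis by simp
qed

text \<open>The torus records the first column and the ratios of the first row to its first entry; entry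
  \<open>(i,j)\<close> divided by the product of the two scaling factors, minus one, gives the entry of the
  remaining \<open>2 \<times> 2\<close> matrix.\<close>

lemma class_of_divisor_complement:
  "class_of 9 {y \<in> GL3. divisor y \<noteq> 0} = (\<bbbL> - 1) ^ 5 * class_of 4 V"
proof -
  let ?U = "{y \<in> GL3. divisor y \<noteq> 0}"
  have U: "quasi_affine 9 ?U" using quasi_affine_GL3 ratpoly_divisor by (rule quasi_affine_nonzero)
  have T: "quasi_affine 9 (torus_affine 5 0 V)"
    using quasi_affine_torus_affine[OF quasi_affine_V, of 5 0] by simp
  have T_iff: "x \<in> torus_affine 5 0 V \<longleftrightarrow> (\<exists>r1 r2 r3 s t a b c d. x = [r1, r2, r3, s, t, a, b, c, d] \<and>
      r1 \<noteq> 0 \<and> r2 \<noteq> 0 \<and> r3 \<noteq> 0 \<and> s \<noteq> 0 \<and> t \<noteq> 0 \<and> a * d - b * c \<noteq> 0 \<and> b + 1 \<noteq> 0)" for x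
    by (auto simp: torus_affine_iff V_iff)
  have U_iff: "x \<in> ?U \<longleftrightarrow> (\<exists>a b c d e f g h i. x = [a, b, c, d, e, f, g, h, i] \<and>
      a * (e * i - f * h) - b * (d * i - f * g) + c * (d * h - e * g) \<noteq> 0 \<and>
      a \<noteq> 0 \<and> b \<noteq> 0 \<and> c \<noteq> 0 \<and> d \<noteq> 0 \<and> f \<noteq> 0 \<and> g \<noteq> 0)" for x
    by (auto simp: GL3_iff divisor_def)
  have "class_of 9 ?U = class_of 9 (torus_affine 5 0 V)"
  proof (rule class_of_coordinates[OF U T,
          where fs = "[\<lambda>x. x ! 0, \<lambda>x. x ! 3, \<lambda>x. x ! 6, \<lambda>x. x ! 1 / x ! 0, \<lambda>x. x ! 2 / x ! 0,
                \<lambda>x. x ! 4 * x ! 0 / (x ! 3 * x ! 1) - 1, \<lambda>x. x ! 5 * x ! 0 / (x ! 3 * x ! 2) - 1,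
                \<lambda>x. x ! 7 * x ! 0 / (x ! 6 * x ! 1) - 1, \<lambda>x. x ! 8 * x ! 0 / (x ! 6 * x ! 2) - 1]"
            and gs = "[\<lambda>y. y ! 0, \<lambda>y. y ! 0 * y ! 3, \<lambda>y. y ! 0 * y ! 4,
                \<lambda>y. y ! 1, \<lambda>y. y ! 1 * y ! 3 * (y ! 5 + 1), \<lambda>y. y ! 1 * y ! 4 * (y ! 6 + 1),
                \<lambda>y. y ! 2, \<lambda>y. y ! 2 * y ! 3 * (y ! 7 + 1), \<lambda>y. y ! 2 * y ! 4 * (y ! 8 + 1)]"],
        goal_cases)
    case 1 show ?case unfolding list.pred_inject
      by (intro conjI TrueI regular_intros U) (auto simp: divisor_def)
  next
    case 3 show ?case unfolding list.pred_inject by (intro conjI TrueI regular_intros T) simp_all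
  next
    case (5 x)
    then obtain a b c d e f g h i where x: "x = [a, b, c, d, e, f, g, h, i]"
      and det: "a * (e * i - f * h) - b * (d * i - f * g) + c * (d * h - e * g) \<noteq> 0"
      and nz: "a \<noteq> 0" "b \<noteq> 0" "c \<noteq> 0" "d \<noteq> 0" "f \<noteq> 0" "g \<noteq> 0"
      unfolding U_iff by blast
    have eq: "(e * a / (d * b) - 1) * (i * a / (g * c) - 1) - (f * a / (d * c) - 1) * (h * a / (g * b) - 1)
        = (a * (e * i - f * h) - b * (d * i - f * g) + c * (d * h - e * g)) * a / (b * c * d * g)"
      using nz by (simp add: field_simps)
    have "(e * a / (d * b) - 1) * (i * a / (g * c) - 1) - (f * a / (d * c) - 1) * (h * a / (g * b) - 1) \<noteq> 0"
      unfolding eq using det nz by simp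
    then show ?case unfolding T_iff U_iff x using nz by simp
  next
    case (6 y)
    then obtain r1 r2 r3 s t a b c d where y: "y = [r1, r2, r3, s, t, a, b, c, d]"
      and nz: "r1 \<noteq> 0" "r2 \<noteq> 0" "r3 \<noteq> 0" "s \<noteq> 0" "t \<noteq> 0" "a * d - b * c \<noteq> 0" "b + 1 \<noteq> 0"
      unfolding T_iff by blast
    have eq: "r1 * ((r2 * s * (a + 1)) * (r3 * t * (d + 1)) - (r2 * t * (b + 1)) * (r3 * s * (c + 1)))
      - r1 * s * (r2 * (r3 * t * (d + 1)) - (r2 * t * (b + 1)) * r3)
      + r1 * t * (r2 * (r3 * s * (c + 1)) - (r2 * s * (a + 1)) * r3)
      = r1 * r2 * r3 * s * t * (a * d - b * c)"
      by (simp add: algebra_simps)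
    show ?case unfolding T_iff U_iff y using nz by (simp add: eq del: right_minus_eq)
  qed simp_all
  then show ?thesis
    using class_of_torus_affine[OF quasi_affine_V, of 5 0] by simp
qed

lemma det_matrix_of: "det (matrix_of x) = det3 x"
  by (simp add: det_3 matrix_of_def det3_def algebra_simps)

lemma class_of_Sigma_minus_det:
  "class_of 9 (divisor_Sigma - (det_hypersurface \<inter> divisor_Sigma)) = class_of 9 {y \<in> GL3. divisor y = 0}"
proof -
  let ?S = "{x \<in> GL3. x ! 1 * x ! 2 * x ! 5 * (x ! 0 + x ! 1 + x ! 2) * (x ! 3 + x ! 4 + x ! 5) *
      (x ! 6 + x ! 7 + x ! 8) = 0}"
  let ?Z = "{y \<in> GL3. divisor y = 0}"
  have eq: "divisor_Sigma - (det_hypersurface \<inter> divisor_Sigma) = ?S"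
    by (auto simp: divisor_Sigma_def det_hypersurface_def GL3_def det_matrix_of)
      (auto simp: matrix_of_def)
  have S: "quasi_affine 9 ?S"
    by (intro quasi_affine_zero quasi_affine_GL3 ratpoly_intros) simp_all
  have Z: "quasi_affine 9 ?Z" using quasi_affine_GL3 ratpoly_divisor by (rule quasi_affine_zero)
  show ?thesis unfolding eq
  proof (rule class_of_coordinates[OF S Z,
          where fs = "[\<lambda>x. x ! 0 + x ! 1 + x ! 2, \<lambda>x. x ! 1, \<lambda>x. x ! 2,
                \<lambda>x. x ! 3 + x ! 4 + x ! 5, \<lambda>x. x ! 4, \<lambda>x. x ! 5,
                \<lambda>x. x ! 6 + x ! 7 + x ! 8, \<lambda>x. x ! 7, \<lambda>x. x ! 8]"
            and gs = "[\<lambda>y. y ! 0 - y ! 1 - y ! 2, \<lambda>y. y ! 1, \<lambda>y. y ! 2,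
                \<lambda>y. y ! 3 - y ! 4 - y ! 5, \<lambda>y. y ! 4, \<lambda>y. y ! 5,
                \<lambda>y. y ! 6 - y ! 7 - y ! 8, \<lambda>y. y ! 7, \<lambda>y. y ! 8]"],
        goal_cases)
    case 1 show ?case unfolding list.pred_inject by (intro conjI TrueI regular_intros S) simp_all
  next
    case 3 show ?case unfolding list.pred_inject by (intro conjI TrueI regular_intros Z) simp_all
  next
    case (5 x)
    then obtain a b c d e f g h i where x: "x = [a, b, c, d, e, f, g, h, i]"
      unfolding GL3_iff by blast
    have "det3 [a + b + c, b, c, d + e + f, e, f, g + h + i, h, i] = det3 x"
      unfolding x det3_def by (simp add: algebra_simps)
    then show ?case using 5 unfolding x by (simp add: GL3_def divisor_def) blast
  next
    case (6 y)
    then obtain a b c d e f g h i where y: "y = [a, b, c, d, e, f, g, h, i]"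
      unfolding GL3_iff by blast
    have "det3 [a - b - c, b, c, d - e - f, e, f, g - h - i, h, i] = det3 y"
      unfolding y det3_def by (simp add: algebra_simps)
    then show ?case using 6 unfolding y by (simp add: GL3_def divisor_def) blast
  qed simp_all
qed

section \<open>Assembling the class\<close>

text \<open>Both sides carry the factor \<open>l (l - 1)^3\<close>.  It is split off while \<open>l - 1\<close> is treated as an
  independent variable \<open>m\<close>, so that the expansions stay small.\<close>

lemma polynomial_identity:
  fixes l :: "'a :: comm_ring_1"
  defines "g \<equiv> (l - 1) ^ 2 * l + (l - 1) ^ 2 * l ^ 2"
  shows "(l - 1) * l ^ 2 * g + (l - 1) * l ^ 3 * g + (l - 1) * l ^ 4 * g - (l - 1) ^ 5 * (g - (l - 1) * l ^ 2)
    = l * (6 * l ^ 4 - 3 * l ^ 3 + 2 * l ^ 2 + 2 * l - 1) * (l - 1) ^ 3"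
proof -
  have factor: "m * l ^ 2 * (m ^ 2 * l + m ^ 2 * l ^ 2) + m * l ^ 3 * (m ^ 2 * l + m ^ 2 * l ^ 2)
      + m * l ^ 4 * (m ^ 2 * l + m ^ 2 * l ^ 2) - m ^ 5 * (m ^ 2 * l + m ^ 2 * l ^ 2 - m * l ^ 2)
    = l * (l ^ 2 * (1 + l) * (1 + l + l ^ 2) - m ^ 3 * (m * (1 + l) - l)) * m ^ 3" for m :: 'a
    by (simp add: algebra_simps power_numeral_reduce)
  have "l ^ 2 * (1 + l) * (1 + l + l ^ 2) - (l - 1) ^ 3 * ((l - 1) * (1 + l) - l)
      = 6 * l ^ 4 - 3 * l ^ 3 + 2 * l ^ 2 + 2 * l - 1"
    by (simp add: algebra_simps power_numeral_reduce)
  then show ?thesis unfolding g_def factor by simp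
qed

text \<open>To be in the class \<open>comm_ring_1\<close> the Grothendieck ring would have to be shown nontrivial.  The
  polynomial identity is instead proved for representatives in the
  symbol ring and transported along the quotient map.\<close>

lemma abs_K0_numeral: "numeral k = abs_K0 (numeral k)"
proof (induction k)
  case (Bit0 k)
  then show ?case by (simp only: numeral_Bit0 plus_K0.abs_eq)
next
  case (Bit1 k)
  then show ?case by (simp only: numeral_Bit1 plus_K0.abs_eq one_K0_def)
qed (simp add: one_K0_def)

lemma abs_K0_power: "abs_K0 a ^ n = abs_K0 (a ^ n)"
  by (induction n) (simp_all only: power_0 power_Suc times_K0.abs_eq one_K0_def)

lemmas abs_K0_hom =
  one_K0_def abs_K0_numeral plus_K0.abs_eq minus_K0.abs_eq times_K0.abs_eq abs_K0_power

theorem mainTheorem7: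
  shows "class_of 9 (divisor_Sigma - (det_hypersurface \<inter> divisor_Sigma))
         = \<bbbL> * (6 * \<bbbL>^4 - 3 * \<bbbL>^3 + 2 * \<bbbL>^2 + 2 * \<bbbL> - 1) * (\<bbbL> - 1)^3"
proof -
  have "class_of 9 GL3 = class_of 9 {y \<in> GL3. divisor y = 0} + class_of 9 {y \<in> GL3. divisor y \<noteq> 0}"
    using quasi_affine_GL3 ratpoly_divisor by (rule class_of_scissors)
  then have *: "class_of 9 (divisor_Sigma - (det_hypersurface \<inter> divisor_Sigma))
      = class_of 9 GL3 - class_of 9 {y \<in> GL3. divisor y \<noteq> 0}"
    by (simp only: class_of_Sigma_minus_det add_diff_cancel_right')
  have "\<exists>l. \<bbbL> = abs_K0 l"
    by (rule K0.abs_induct[of "\<lambda>k. \<exists>l. k = abs_K0 l"]) blast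
  then obtain l where l: "\<bbbL> = abs_K0 l" ..
  show ?thesis
    unfolding * class_of_GL3 class_of_divisor_complement class_of_V class_of_GL2 l abs_K0_hom
    by (rule arg_cong[of _ _ abs_K0]) (rule polynomial_identity)
qed

end
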